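(* Let $(X,Z)$ be a $\mathrm{CBITCL}(X_0,\Psi,\Phi,\Xi,\rho)$ and suppose that, if $\psi\wedge\phi<\infty$, then $\int_1^\infty x\,e^{(\psi\wedge\phi)x}\,\pi(dx)<\infty$. Then, for every $(u_1,u_2,u_3)\in\mathcal{D}_X\times\mathbb{R}\times\mathcal{D}_Z$, the lifetime $\mathrm{T}^{(u_1,u_2,u_3)}$ of the solution to the extended Riccati system is given as follows: (i) if $u_1\le\chi^{(u_2,u_3)}$, then $\mathrm{T}^{(u_1,u_2,u_3)}=+\infty$; (ii) if $u_1>\chi^{(u_2,u_3)}$, then $$\mathrm{T}^{(u_1,u_2,u_3)}=\int_{u_1}^{\psi\wedge\phi}\frac{dx}{\Phi(x)+u_2+\rho\,\sigma_X\sigma_Z\,u_3\,x+\Xi(u_3)}.$$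
   Context: Parameters: $\beta\ge0$; $b_X,b_Z\in\mathbb{R}$; $\sigma_X,\sigma_Z\ge0$; $\rho\in[-1,1]$; $\nu$ a Lévy measure on $\mathbb{R}_+$ with $\int_0^1x\,\nu(dx)<\infty$; $\pi$ a Lévy measure on $\mathbb{R}_+$ with $\int_1^\infty x\,\pi(dx)<\infty$; $\gamma$ a Lévy measure on $\mathbb{R}$. Exponents: $$\Psi(u)=\beta u+\int_{\mathbb{R}_+}(e^{ux}-1)\nu(dx),\qquad\Phi(u)=-b_Xu+\tfrac12\sigma_X^2u^2+\int_{\mathbb{R}_+}(e^{ux}-1-ux)\pi(dx),$$ $$\Xi(u)=b_Zu+\tfrac12\sigma_Z^2u^2+\int_{\mathbb{R}}(e^{uz}-1-uz\mathbf{1}_{\{|z|<1\}})\gamma(dz),$$ where $\Psi,\Phi$ are defined for complex $u$ with non-positive real part, $\Xi$ for purely imaginary $u$, and all are extended by the same formulas to real arguments (with values in $(-\infty,+\infty]$). $\mathrm{CBITCL}(X_0,\Psi,\Phi,\Xi,\rho)$, with $X_0\ge0$: a process $(X,Z)$ with values in $\mathbb{R}_+\times\mathbb{R}$ such that $X_t=X_0+M_{Y_t}+K_t$ and $Z_t=N_{Y_t}$ for all $t\ge0$, where $Y_t=\int_0^tX_s\,ds$, $K$ is a Lévy process with exponent $\Psi$ and $(M,N)$ is a two-dimensional Lévy process, independent of $K$, with exponent $\Lambda(u_1,u_2)=\Phi(u_1)+\rho\sigma_X\sigma_Zu_1u_2+\Xi(u_2)$, i.e. $\mathbb{E}[e^{u_1M_t+u_2N_t}]=e^{t\Lambda(u_1,u_2)}$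 for $\mathrm{Re}\,u_1\le0$, $u_2\in\mathrm{i}\mathbb{R}$. Domains: $\mathcal{D}_X=\{u\in\mathbb{R}:\int_1^\infty e^{ux}(\nu+\pi)(dx)<\infty\}$, $\mathcal{D}_Z=\{u\in\mathbb{R}:\int_{|z|\ge1}e^{uz}\gamma(dz)<\infty\}$, $\psi=\sup\{x\ge0:\Psi(x)<\infty\}$, $\phi=\sup\{x\ge0:\Phi(x)<\infty\}$. Extended Riccati system: for $(u_1,u_2,u_3)\in\mathcal{D}_X\times\mathbb{R}\times\mathcal{D}_Z$, $$\mathcal{U}(t)=\int_0^t\Psi(\mathcal{V}(s))\,ds,\qquad\frac{\partial\mathcal{V}}{\partial t}(t)=\Phi(\mathcal{V}(t))+u_2+\rho\,\sigma_X\sigma_Z\,u_3\,\mathcal{V}(t)+\Xi(u_3),\quad\mathcal{V}(0)=u_1,$$ with $\mathcal{U}$ real-valued and $\mathcal{V}$ valued in $\mathcal{D}_X$. Under the stated integrability hypothesis on $\pi$ the solution is unique; $\mathrm{T}^{(u_1,u_2,u_3)}\in[0,+\infty]$ denotes its (maximal) joint lifetime, i.e. $(\mathcal{U},\mathcal{V})$ exists on $[0,\mathrm{T}^{(u_1,u_2,u_3)})$ and not beyond. Finally, $\mathcal{S}^{(u_2,u_3)}=\{x\in\mathcal{D}_X:\Phi(x)+u_2+\rho\,\sigma_X\sigma_Z\,u_3\,x+\Xi(u_3)\le0\}$ and $\chi^{(u_2,u_3)}=\sup\mathcal{S}^{(u_2,u_3)}\in[-\infty,\psi\wedge\phi]$,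 with $\chi^{(u_2,u_3)}=-\infty$ if $\mathcal{S}^{(u_2,u_3)}=\emptyset$. *)

theory Defs
  imports "HOL-Probability.Probability"
begin

section \<open>Parameters\<close>

text \<open>
  All measures live on the Borel sets of the real line; a Levy measure on $[0,\infty)$ is a Levy
  measure that does not charge the negative half-line (nor the origin).
\<close>

definition levy_measure :: "real measure \<Rightarrow> bool" where
  "levy_measure m \<longleftrightarrow> sets m = sets borel \<and> emeasure m {0} = 0
     \<and> (\<integral>\<^sup>+x. ennreal (min 1 (x\<^sup>2)) \<partial>m) < \<infinity>"

definition levy_measure_nonneg :: "real measure \<Rightarrow> bool" where
  "levy_measure_nonneg m \<longleftrightarrow> levy_measure m \<and> emeasure m {..<0} = 0"

record cbitcl_params =
  beta :: real
  b_X :: real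
  b_Z :: real
  sigma_X :: real
  sigma_Z :: real
  rho :: real
  levy_nu :: "real measure"
  levy_pi :: "real measure"
  levy_gamma :: "real measure"

definition admissible :: "cbitcl_params \<Rightarrow> bool" where
  "admissible p \<longleftrightarrow>
     0 \<le> beta p \<and> 0 \<le> sigma_X p \<and> 0 \<le> sigma_Z p \<and> -1 \<le> rho p \<and> rho p \<le> 1 \<and>
     levy_measure_nonneg (levy_nu p) \<and> (\<integral>\<^sup>+x\<in>{0..1}. ennreal x \<partial>levy_nu p) < \<infinity> \<and>
     levy_measure_nonneg (levy_pi p) \<and> (\<integral>\<^sup>+x\<in>{1..}. ennreal x \<partial>levy_pi p) < \<infinity> \<and>
     levy_measure (levy_gamma p)"


section \<open>Exponents\<close>

subsection \<open>Complex arguments\<close>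

text \<open>
  The integrals converge for \<open>Re u \<le> 0\<close> (\<open>Psi_c\<close>, \<open>Phi_c\<close>) and for purely imaginary
  \<open>u\<close> (\<open>Xi_c\<close>); the functions are only used there.
\<close>

definition Psi_c :: "cbitcl_params \<Rightarrow> complex \<Rightarrow> complex" where
  "Psi_c p u = of_real (beta p) * u + (\<integral>x. exp (u * of_real x) - 1 \<partial>levy_nu p)"

definition Phi_c :: "cbitcl_params \<Rightarrow> complex \<Rightarrow> complex" where
  "Phi_c p u = - of_real (b_X p) * u + 1 / 2 * of_real ((sigma_X p)\<^sup>2) * u\<^sup>2
     + (\<integral>x. exp (u * of_real x) - 1 - u * of_real x \<partial>levy_pi p)"

definition Xi_c :: "cbitcl_params \<Rightarrow> complex \<Rightarrow> complex" where
  "Xi_c p u = of_real (b_Z p) * u + 1 / 2 * of_real ((sigma_Z p)\<^sup>2) * u\<^sup>2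
     + (\<integral>z. exp (u * of_real z) - 1 - (if \<bar>z\<bar> < 1 then u * of_real z else 0) \<partial>levy_gamma p)"

definition Lambda_c :: "cbitcl_params \<Rightarrow> complex \<Rightarrow> complex \<Rightarrow> complex" where
  "Lambda_c p u1 u2 =
     Phi_c p u1 + of_real (rho p * sigma_X p * sigma_Z p) * u1 * u2 + Xi_c p u2"

subsection \<open>Real arguments, with values in \<open>(-\<infinity>, \<infinity>]\<close>\<close>

text \<open>
  Integral of the positive part minus integral of the negative part. For the three integrands
  below the negative part always has finite integral (given \<open>admissible\<close>), so
  \<open>\<infinity> - \<infinity>\<close> does not occur.
\<close>

definition ext_integral :: "'b measure \<Rightarrow> ('b \<Rightarrow> real) \<Rightarrow> ereal" where
  "ext_integral m f =
     enn2ereal (\<integral>\<^sup>+x. ennreal (f x) \<partial>m) - enn2ereal (\<integral>\<^sup>+x. ennreal (- f x) \<partial>m)"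

definition Psi :: "cbitcl_params \<Rightarrow> real \<Rightarrow> ereal" where
  "Psi p u = ereal (beta p * u) + ext_integral (levy_nu p) (\<lambda>x. exp (u * x) - 1)"

definition Phi :: "cbitcl_params \<Rightarrow> real \<Rightarrow> ereal" where
  "Phi p u = ereal (- b_X p * u + 1 / 2 * (sigma_X p)\<^sup>2 * u\<^sup>2)
     + ext_integral (levy_pi p) (\<lambda>x. exp (u * x) - 1 - u * x)"

definition Xi :: "cbitcl_params \<Rightarrow> real \<Rightarrow> ereal" where
  "Xi p u = ereal (b_Z p * u + 1 / 2 * (sigma_Z p)\<^sup>2 * u\<^sup>2)
     + ext_integral (levy_gamma p) (\<lambda>z. exp (u * z) - 1 - (if \<bar>z\<bar> < 1 then u * z else 0))"


section \<open>CBI-time-changed Levy processes\<close>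

definition cadlag :: "(real \<Rightarrow> 'b::topological_space) \<Rightarrow> bool" where
  "cadlag f \<longleftrightarrow> (\<forall>t\<ge>0. continuous (at_right t) f) \<and> (\<forall>t>0. \<exists>l. (f \<longlongrightarrow> l) (at_left t))"

text \<open>Processes are indexed by \<open>real\<close>, but only times \<open>t \<ge> 0\<close> are relevant.\<close>

definition levy_process ::
  "'a measure \<Rightarrow> (real \<Rightarrow> 'a \<Rightarrow> 'b::euclidean_space) \<Rightarrow> bool" where
  "levy_process P L \<longleftrightarrow>
     (\<forall>t\<ge>0. L t \<in> borel_measurable P) \<and>
     (AE \<omega> in P. L 0 \<omega> = 0) \<and>
     (\<forall>(n::nat) (t::nat \<Rightarrow> real). 0 \<le> t 0 \<and> mono t \<longrightarrow>
        prob_space.indep_vars P (\<lambda>_. borel) (\<lambda>i \<omega>. L (t (Suc i)) \<omega> - L (t i) \<omega>) {..<n}) \<and>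
     (\<forall>s\<ge>0. \<forall>h\<ge>0.
        distr P borel (\<lambda>\<omega>. L (s + h) \<omega> - L s \<omega>) = distr P borel (L h)) \<and>
     (AE \<omega> in P. cadlag (\<lambda>t. L t \<omega>))"

definition process_events ::
  "'a measure \<Rightarrow> (real \<Rightarrow> 'a \<Rightarrow> 'b::topological_space) \<Rightarrow> 'a set set" where
  "process_events P L =
     sigma_sets (space P) {L t -` A \<inter> space P | t A. 0 \<le> t \<and> A \<in> sets borel}"

text \<open>Independence of the processes as a whole, i.e. of the generated sigma-algebras.\<close>

definition indep_processes ::
  "'a measure \<Rightarrow> (real \<Rightarrow> 'a \<Rightarrow> 'b::topological_space)
     \<Rightarrow> (real \<Rightarrow> 'a \<Rightarrow> 'c::topological_space) \<Rightarrow> bool" where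
  "indep_processes P L L' \<longleftrightarrow>
     prob_space.indep_set P (process_events P L) (process_events P L')"

text \<open>
  The two exponent conditions include the existence of the expectations, since a
  non-integrable function has Bochner integral \<open>0\<close>, which is not an exponential.
  The path integrability of \<open>X\<close> is what makes the time change \<open>Y\<close> well defined.
\<close>

definition CBITCL ::
  "'a measure \<Rightarrow> real \<Rightarrow> cbitcl_params \<Rightarrow> (real \<Rightarrow> 'a \<Rightarrow> real) \<Rightarrow> (real \<Rightarrow> 'a \<Rightarrow> real) \<Rightarrow> bool" where
  "CBITCL P X0 p X Z \<longleftrightarrow>
     prob_space P \<and> 0 \<le> X0 \<and>
     (\<forall>t\<ge>0. X t \<in> borel_measurable P \<and> Z t \<in> borel_measurable P) \<and>
     (\<forall>t\<ge>0. \<forall>\<omega>\<in>space P. 0 \<le> X t \<omega>) \<and>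
     (\<exists>K M N.
        levy_process P K \<and>
        (\<forall>t\<ge>0. \<forall>u. Re u \<le> 0 \<longrightarrow>
           (\<integral>\<omega>. exp (u * of_real (K t \<omega>)) \<partial>P) = exp (of_real t * Psi_c p u)) \<and>
        levy_process P (\<lambda>t \<omega>. (M t \<omega>, N t \<omega>)) \<and>
        (\<forall>t\<ge>0. \<forall>u1 u2. Re u1 \<le> 0 \<and> Re u2 = 0 \<longrightarrow>
           (\<integral>\<omega>. exp (u1 * of_real (M t \<omega>) + u2 * of_real (N t \<omega>)) \<partial>P)
             = exp (of_real t * Lambda_c p u1 u2)) \<and>
        indep_processes P (\<lambda>t \<omega>. (M t \<omega>, N t \<omega>)) K \<and>
        (AE \<omega> in P. \<forall>t\<ge>0.
           set_integrable lborel {0..t} (\<lambda>s. X s \<omega>) \<and>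
           (let Y = (LBINT s:{0..t}. X s \<omega>)
            in X t \<omega> = X0 + M Y \<omega> + K t \<omega> \<and> Z t \<omega> = N Y \<omega>)))"


section \<open>The extended Riccati system\<close>

definition D_X :: "cbitcl_params \<Rightarrow> real set" where
  "D_X p = {u. (\<integral>\<^sup>+x\<in>{1..}. ennreal (exp (u * x)) \<partial>levy_nu p)
             + (\<integral>\<^sup>+x\<in>{1..}. ennreal (exp (u * x)) \<partial>levy_pi p) < \<infinity>}"

definition D_Z :: "cbitcl_params \<Rightarrow> real set" where
  "D_Z p = {u. (\<integral>\<^sup>+z\<in>{z. 1 \<le> \<bar>z\<bar>}. ennreal (exp (u * z)) \<partial>levy_gamma p) < \<infinity>}"

definition psi_sup :: "cbitcl_params \<Rightarrow> ereal" where
  "psi_sup p = Sup (ereal ` {x. 0 \<le> x \<and> Psi p x < \<infinity>})"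

definition phi_sup :: "cbitcl_params \<Rightarrow> ereal" where
  "phi_sup p = Sup (ereal ` {x. 0 \<le> x \<and> Phi p x < \<infinity>})"

definition riccati_rhs :: "cbitcl_params \<Rightarrow> real \<Rightarrow> real \<Rightarrow> real \<Rightarrow> ereal" where
  "riccati_rhs p u2 u3 x =
     Phi p x + ereal u2 + ereal (rho p * sigma_X p * sigma_Z p * u3 * x) + Xi p u3"

text \<open>
  A solution on the half-open interval $[0,\tau)$. Since \<open>V\<close> stays in \<open>D_X p\<close> (and
  \<open>u3 \<in> D_Z p\<close>), the extended-real quantities converted by \<open>real_of_ereal\<close> are finite.
  At \<open>t = 0\<close> the derivative is one-sided.
\<close>

definition riccati_solution ::
  "cbitcl_params \<Rightarrow> real \<Rightarrow> real \<Rightarrow> real \<Rightarrow> ennreal \<Rightarrow> (real \<Rightarrow> real) \<Rightarrow> (real \<Rightarrow> real) \<Rightarrow> bool" where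
  "riccati_solution p u1 u2 u3 \<tau> U V \<longleftrightarrow>
     V 0 = u1 \<and>
     (\<forall>t\<ge>0. ennreal t < \<tau> \<longrightarrow>
        V t \<in> D_X p \<and>
        set_integrable lborel {0..t} (\<lambda>s. real_of_ereal (Psi p (V s))) \<and>
        U t = (LBINT s:{0..t}. real_of_ereal (Psi p (V s))) \<and>
        (V has_real_derivative real_of_ereal (riccati_rhs p u2 u3 (V t)))
          (at t within {s. 0 \<le> s \<and> ennreal s < \<tau>}))"

text \<open>For \<open>\<tau> = 0\<close> the interval $[0,\tau)$ is empty, so the supremum is over a nonempty set.\<close>

definition riccati_lifetime :: "cbitcl_params \<Rightarrow> real \<Rightarrow> real \<Rightarrow> real \<Rightarrow> ennreal" where
  "riccati_lifetime p u1 u2 u3 = Sup {\<tau>. \<exists>U V. riccati_solution p u1 u2 u3 \<tau> U V}"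

definition S_set :: "cbitcl_params \<Rightarrow> real \<Rightarrow> real \<Rightarrow> real set" where
  "S_set p u2 u3 = {x \<in> D_X p. riccati_rhs p u2 u3 x \<le> 0}"

definition chi :: "cbitcl_params \<Rightarrow> real \<Rightarrow> real \<Rightarrow> ereal" where
  "chi p u2 u3 = Sup (ereal ` S_set p u2 u3)"

end

theory Submission
  imports Defs
begin

text \<open>
  Write \<open>F x = \<Phi>(x) + u2 + \<rho> \<sigma>\<^sub>X \<sigma>\<^sub>Z u3 x + \<Xi>(u3)\<close> and \<open>\<kappa> = min \<psi> \<phi>\<close>. The second Riccati
  equation is the scalar autonomous equation \<open>V' = F(V)\<close>, and the first one only requires that
  \<open>\<Psi>(V)\<close> be integrable, which holds on compact time intervals because \<open>\<Psi>\<close> is continuous on the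
  domain \<open>D_X\<close> of exponential moments. Hence the lifetime is that of a flow on the line that must
  stay inside \<open>D_X\<close>, an interval unbounded to the left with supremum \<open>\<kappa>\<close>. Separation of variables
  settles everything: while \<open>F\<close> keeps a sign, the time spent going from \<open>c\<close> to \<open>d\<close> is the integral
  of \<open>1 / F\<close> (lemma \<open>increasing_flow_exists\<close>).

  If \<open>u1 > \<chi>\<close>, then \<open>F > 0\<close> on \<open>D_X\<close> from \<open>u1\<close> onwards. The solution obtained by separation of
  variables lives exactly until it has travelled from \<open>u1\<close> to \<open>\<kappa>\<close>. Conversely, any solution
  starts upwards and can never come back, so a time \<open>t\<close> in its life equals the travel time from
  \<open>u1\<close> to \<open>V t \<le> \<kappa>\<close> and is bounded by the integral up to \<open>\<kappa>\<close> (lemma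
  \<open>positive_flow_time_le\<close>).

  If \<open>u1 \<le> \<chi>\<close>, then \<open>F b \<le> 0\<close> for some \<open>b \<ge> u1\<close> in \<open>D_X\<close>, and the flow rests or moves
  monotonically towards a zero of \<open>F\<close> or, without a zero to the left of \<open>u1\<close>, towards \<open>-\<infinity>\<close>.
  It takes an infinite time in each case (lemma \<open>convex_flow_global\<close>): \<open>F\<close> is convex, so a chord bounds \<open>\<bar>F\<bar>\<close> linearly
  by the distance to the zero that is approached, and \<open>F\<close> lies above an affine function, so the
  descent to \<open>-\<infinity>\<close> has at most linear speed. Convexity, continuity and the affine bound come from
  the form of the jump integrand \<open>exp (u x) - 1 - u x\<close>, which is nonnegative and convex in \<open>u\<close>.
\<close>

section \<open>Travel times of scalar autonomous equations\<close>

text \<open>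
  The time that \<open>V' = f(V)\<close> needs from \<open>c\<close> to \<open>d\<close>, for \<open>f > 0\<close> in between. The endpoint \<open>d\<close> may be
  infinite.
\<close>

definition travel_time :: "(real \<Rightarrow> real) \<Rightarrow> real \<Rightarrow> ereal \<Rightarrow> ennreal" where
  "travel_time f c d = (\<integral>\<^sup>+x\<in>{x. c < x \<and> ereal x < d}. ennreal (1 / f x) \<partial>lborel)"

lemma nn_integral_FTC_nonneg:
  fixes H h :: "real \<Rightarrow> real"
  assumes "c \<le> x"
    and der: "\<And>y. y \<in> {c..x} \<Longrightarrow> (H has_real_derivative h y) (at y within {c..x})"
    and nonneg: "\<And>y. y \<in> {c..x} \<Longrightarrow> 0 \<le> h y"
  shows "(\<integral>\<^sup>+y\<in>{c<..<x}. ennreal (h y) \<partial>lborel) = ennreal (H x - H c)"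
proof -
  have "(h has_integral (H x - H c)) {c..x}"
    using assms(1) der
    by (intro fundamental_theorem_of_calculus)
       (auto simp: has_real_derivative_iff_has_vector_derivative)
  then have "(h has_integral (H x - H c)) {c<..<x}"
    using has_integral_Icc_iff_Ioo by blast
  then show ?thesis
    using nonneg by (intro nn_integral_has_integral_lebesgue') auto
qed

text \<open>
  Bounds the travel time from below by any explicit antiderivative \<open>H\<close> whose derivative is dominated
  by \<open>1 / f\<close>; logarithms will show that it is infinite.
\<close>

lemma travel_time_ge_increment:
  fixes H h f :: "real \<Rightarrow> real"
  assumes "c \<le> x" and "ereal x \<le> d"
    and der: "\<And>y. y \<in> {c..x} \<Longrightarrow> (H has_real_derivative h y) (at y within {c..x})"
    and bnd: "\<And>y. y \<in> {c..x} \<Longrightarrow> 0 \<le> h y"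
      "\<And>y. y \<in> {c<..<x} \<Longrightarrow> h y \<le> 1 / f y"
  shows "ennreal (H x - H c) \<le> travel_time f c d"
proof -
  have "ennreal (H x - H c) = (\<integral>\<^sup>+y\<in>{c<..<x}. ennreal (h y) \<partial>lborel)"
    using nn_integral_FTC_nonneg[OF assms(1) der bnd(1)] by simp
  also have "\<dots> \<le> travel_time f c d"
    unfolding travel_time_def
  proof (rule nn_integral_mono)
    fix y
    show "ennreal (h y) * indicator {c<..<x} y
        \<le> ennreal (1 / f y) * indicator {x. c < x \<and> ereal x < d} y"
    proof (cases "y \<in> {c<..<x}")
      case True
      then have "ereal y < ereal x" by simp
      also note assms(2)
      finally have "ereal y < d" .
      with True bnd show ?thesis by (auto intro!: ennreal_leI)
    qed auto
  qed
  finally show ?thesis .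
qed

text \<open>
  Monotone convergence along points increasing to \<open>d\<close> reduces the travel time to the travel times on
  compact intervals, where \<open>1 / f\<close> is continuous even if it has no integral up to \<open>d\<close>.
\<close>

lemma travel_time_le:
  fixes f :: "real \<Rightarrow> real"
  assumes cd: "ereal c < d"
    and cont: "continuous_on {x. c \<le> x \<and> ereal x < d} f"
    and pos: "\<And>x. c \<le> x \<Longrightarrow> ereal x < d \<Longrightarrow> 0 < f x"
    and bound: "\<And>x. c \<le> x \<Longrightarrow> ereal x < d \<Longrightarrow> ennreal (integral {c..x} (\<lambda>y. 1 / f y)) \<le> t"
  shows "travel_time f c d \<le> t"
proof -
  obtain X :: "nat \<Rightarrow> real" where X: "incseq X" "\<And>i. c < X i" "\<And>i. ereal (X i) < d"
      "(\<lambda>i. ereal (X i)) \<longlonglongrightarrow> d"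
    using ereal_incseq_approx[OF cd] by (metis less_ereal.simps(1))
  have sub: "y \<in> {x. c \<le> x \<and> ereal x < d}" if "c \<le> y" "y \<le> X i" for y i
    using that X(3)[of i] le_less_trans[of "ereal y" "ereal (X i)" d] by simp
  have conti: "continuous_on {c..X i} (\<lambda>y. 1 / f y)" for i
    using sub pos by (intro continuous_intros continuous_on_subset[OF cont]) fastforce+
  define g where "g i y = ennreal (1 / f y) * indicator {c<..X i} y" for i y
  have [measurable]: "g i \<in> borel_measurable lborel" for i
  proof -
    have "(\<lambda>y. indicator {c<..X i} y *\<^sub>R (1 / f y)) \<in> borel_measurable borel"
      by (intro borel_measurable_continuous_on_indicator continuous_on_subset[OF conti[of i]]) auto
    then have "(\<lambda>y. ennreal (indicator {c<..X i} y *\<^sub>R (1 / f y))) \<in> borel_measurable borel"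
      by measurable
    moreover have "(\<lambda>y. ennreal (indicator {c<..X i} y *\<^sub>R (1 / f y))) = g i"
      by (auto simp: g_def indicator_def)
    ultimately show ?thesis by simp
  qed
  have "incseq g"
    using X(1) by (auto simp: g_def incseq_def le_fun_def indicator_def intro: order_trans)
  have "travel_time f c d = (\<integral>\<^sup>+ y. (SUP i. g i y) \<partial>lborel)"
    unfolding travel_time_def
  proof (rule nn_integral_cong)
    fix y
    show "ennreal (1 / f y) * indicator {x. c < x \<and> ereal x < d} y = (SUP i. g i y)"
    proof (cases "c < y \<and> ereal y < d")
      case True
      then obtain i where "ereal y < ereal (X i)"
        using order_tendstoD(1)[OF X(4), of "ereal y"] by (auto simp: eventually_sequentially)
      then have "g i y = ennreal (1 / f y)" using True by (simp add: g_def)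
      moreover have "g j y \<le> ennreal (1 / f y)" for j by (simp add: g_def indicator_def)
      ultimately have "(SUP i. g i y) = ennreal (1 / f y)"
        by (metis SUP_least SUP_upper UNIV_I antisym)
      then show ?thesis using True by simp
    next
      case False
      then have "g i y = 0" for i using sub[of y i] by (auto simp: g_def indicator_def)
      then show ?thesis using False by auto
    qed
  qed
  also have "\<dots> = (SUP i. \<integral>\<^sup>+ y. g i y \<partial>lborel)"
    by (rule nn_integral_monotone_convergence_SUP[OF \<open>incseq g\<close>]) simp
  also have "\<dots> \<le> t"
  proof (rule SUP_least)
    fix i
    have "((\<lambda>y. 1 / f y) has_integral integral {c..X i} (\<lambda>y. 1 / f y)) {c..X i}"
      by (intro integrable_integral integrable_continuous_interval conti)
    then have "(\<integral>\<^sup>+y\<in>{c..X i}. ennreal (1 / f y) \<partial>lborel) = ennreal (integral {c..X i} (\<lambda>y. 1 / f y))"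
      using sub pos by (intro nn_integral_has_integral_lebesgue') (fastforce intro: less_imp_le)+
    also have "\<dots> \<le> t" using bound X(2,3)[of i] by (simp add: less_imp_le)
    finally show "(\<integral>\<^sup>+ y. g i y \<partial>lborel) \<le> t"
      by (rule order_trans[rotated]) (auto intro!: nn_integral_mono simp: g_def indicator_def)
  qed
  finally show ?thesis .
qed

text \<open>
  Separation of variables: the solution is the inverse of \<open>G x = \<integral> 1 / f\<close> over \<open>[c, x]\<close>. By the
  preceding lemma the values of \<open>G\<close> exhaust all times below the travel time to \<open>d\<close>.
\<close>

lemma increasing_flow_exists:
  fixes f :: "real \<Rightarrow> real"
  assumes cd: "ereal c < d"
    and cont: "continuous_on {x. c \<le> x \<and> ereal x < d} f"
    and pos: "\<And>x. c \<le> x \<Longrightarrow> ereal x < d \<Longrightarrow> 0 < f x"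
  obtains V where "V 0 = c"
    and "\<And>t. 0 \<le> t \<Longrightarrow> ennreal t < travel_time f c d \<Longrightarrow>
           c \<le> V t \<and> ereal (V t) < d \<and> (V has_real_derivative f (V t)) (at t)"
proof -
  \<comment> \<open>Freezing \<open>f\<close> at \<open>f c\<close> to the left of \<open>c\<close> makes \<open>c\<close> an interior point, so that the inverse function rule gives a two-sided derivative at time \<open>0\<close> as well.\<close>
  define a where "a = c - 1"
  define h where "h y = 1 / f (max c y)" for y
  define G where "G x = integral {a..x} h - integral {a..c} h" for x
  have hpos: "0 < h y" if "ereal y < d" for y
    using that pos[of "max c y"] cd by (simp add: h_def max_def)
  have hcont: "continuous_on {a..x} h" if "ereal x < d" for x
  proof -
    have le: "max c y \<in> {x. c \<le> x \<and> ereal x < d}" if "y \<in> {a..x}" for y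
      using that \<open>ereal x < d\<close> cd le_less_trans[of "ereal y" "ereal x" d] by (simp add: max_def)
    have "continuous_on {a..x} (\<lambda>y. f (max c y))"
      using le by (intro continuous_on_compose2[OF cont]) (auto intro!: continuous_intros)
    then show ?thesis
      unfolding h_def using le pos by (intro continuous_intros) fastforce+
  qed
  have hint: "h integrable_on {a..x}" if "ereal x < d" for x
    using hcont[OF that] integrable_continuous_interval by blast
  have ac: "a < c" by (simp add: a_def)
  have Gder: "(G has_real_derivative h x) (at x)" if ax: "a < x" and xd: "ereal x < d" for x
  proof -
    obtain b where b: "ereal x < ereal b" "ereal b < d"
      using xd ereal_dense2 by blast
    have "((\<lambda>x. integral {a..x} h) has_real_derivative h x) (at x within {a..b})"
      using b ax by (intro integral_has_real_derivative hcont) auto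
    moreover have "at x within {a..b} = at x"
      using ax b by (intro at_within_interior) simp
    ultimately show ?thesis unfolding G_def by (auto intro!: derivative_eq_intros)
  qed
  have less: "G x < G y" if "a < x" "x < y" "ereal y < d" for x y
  proof (rule DERIV_pos_imp_increasing[OF that(2)])
    fix z assume "x \<le> z" "z \<le> y"
    then have "ereal z < d" using that(3) le_less_trans[of "ereal z" "ereal y" d] by simp
    then show "\<exists>y. DERIV G z :> y \<and> y > 0"
      using Gder[of z] hpos[of z] \<open>x \<le> z\<close> that(1) by auto
  qed
  have Gc: "G c = 0" by (simp add: G_def)
  define D where "D = {x. a < x \<and> ereal x < d}"
  have "c \<in> D" using cd ac by (simp add: D_def)
  have inj: "inj_on G D"
    by (auto simp: inj_on_def D_def) (metis less less_irrefl linorder_less_linear)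
  define V where "V t = the_inv_into D G t" for t
  have VG: "V (G x) = x" if "x \<in> D" for x
    unfolding V_def using inj that by (rule the_inv_into_f_f)
  have Gint: "G x = integral {c..x} (\<lambda>y. 1 / f y)" if "c \<le> x" "ereal x < d" for x
  proof -
    have "integral {a..c} h + integral {c..x} h = integral {a..x} h"
      using that ac hint by (intro Henstock_Kurzweil_Integration.integral_combine) auto
    moreover have "integral {c..x} h = integral {c..x} (\<lambda>y. 1 / f y)"
      by (rule integral_cong) (simp add: h_def max_def)
    ultimately show ?thesis by (simp add: G_def)
  qed
  have reach: "\<exists>x. c \<le> x \<and> ereal x < d \<and> G x = t" 
    if t: "0 \<le> t" "ennreal t < travel_time f c d" for t
  proof -
    have "\<exists>x. c \<le> x \<and> ereal x < d \<and> t < G x"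
    proof (rule ccontr)
      assume "\<not> ?thesis"
      then have "ennreal (integral {c..x} (\<lambda>y. 1 / f y)) \<le> ennreal t" if "c \<le> x" "ereal x < d" for x
        using that Gint by (intro ennreal_leI) force
      from travel_time_le[OF cd cont pos this] t show False by simp
    qed
    then obtain x where x: "c \<le> x" "ereal x < d" "t < G x" by blast
    have "isCont G y" if "c \<le> y \<and> y \<le> x" for y
      using that ac x(2) le_less_trans[of "ereal y" "ereal x" d] 
      by (intro DERIV_isCont[OF Gder]) auto
    then obtain y where "c \<le> y" "y \<le> x" "G y = t"
      using IVT[of G c t x] x Gc t by auto
    then show ?thesis using x(2) le_less_trans[of "ereal y" "ereal x" d] by auto
  qed
  have "c \<le> V t \<and> ereal (V t) < d \<and> (V has_real_derivative f (V t)) (at t)"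
    if t: "0 \<le> t" "ennreal t < travel_time f c d" for t
  proof -
    obtain x where x: "c \<le> x" "ereal x < d" "G x = t" using reach[OF t] by blast
    then have Vt: "V t = x" using VG ac by (auto simp: D_def)
    obtain b where b: "ereal x < ereal b" "ereal b < d" using x(2) ereal_dense2 by blast
    define l where "l = (a + c) / 2"
    have l: "a < l" "l < x" using ac x by (auto simp: l_def)
    have inD: "z \<in> D" if "l \<le> z" "z \<le> b" for z
      using that l b le_less_trans[of "ereal z" "ereal b" d] by (auto simp: D_def)
    have Gcont: "isCont G z" if "l \<le> z" "z \<le> b" for z
      using inD[OF that] by (auto simp: D_def intro: DERIV_isCont Gder)
    have cV: "isCont V (G x)"
      using l b inD by (intro isCont_inverse_function2[of l x b V G] VG Gcont) auto
    have "G (V y) = y" if y: "G l < y" "y < G b" for y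
    proof -
      have lb: "l \<le> b" using l b by simp
      have "\<forall>z. l \<le> z \<and> z \<le> b \<longrightarrow> isCont G z" using Gcont by blast
      from IVT[OF less_imp_le[OF y(1)] less_imp_le[OF y(2)] lb this]
      obtain z where z: "l \<le> z" "z \<le> b" "G z = y" by metis
      show ?thesis using VG[OF inD[OF z(1,2)]] z(3) by simp
    qed
    moreover have "G l < t" "t < G b" using less[of l x] less[of x b] l b x by auto
    moreover have "(G has_real_derivative h (V t)) (at (V t))" using Gder[of x] x ac Vt by auto
    moreover have "h (V t) \<noteq> 0" using hpos[of x] x Vt by auto
    ultimately have "(V has_real_derivative inverse (h (V t))) (at t)"
      using cV x by (intro DERIV_inverse_function[where f = G and a = "G l" and b = "G b"]) auto
    moreover have "inverse (h (V t)) = f (V t)" using x Vt by (simp add: h_def max_def)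
    ultimately show ?thesis using x Vt by simp
  qed
  moreover have "V 0 = c" using VG[OF \<open>c \<in> D\<close>] Gc by simp
  ultimately show ?thesis using that by blast
qed

text \<open>
  The primitive \<open>-ln (d - x) / A\<close> of the lower bound \<open>1 / (A (d - x))\<close> of \<open>1 / f\<close> is unbounded near
  \<open>d\<close>: a point that is approached with at most linear speed is not reached in finite time.
\<close>

lemma travel_time_barrier:
  fixes f :: "real \<Rightarrow> real"
  assumes "c < d" and pos: "\<And>x. c \<le> x \<Longrightarrow> x < d \<Longrightarrow> 0 < f x"
    and le: "\<And>x. c \<le> x \<Longrightarrow> x < d \<Longrightarrow> f x \<le> A * (d - x)"
  shows "travel_time f c (ereal d) = \<infinity>"
proof (rule ccontr)
  assume "travel_time f c (ereal d) \<noteq> \<infinity>"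
  then obtain t where t: "travel_time f c (ereal d) = ennreal t" "0 \<le> t"
    by (cases "travel_time f c (ereal d)") auto
  have A: "0 < A"
    using pos[of c] le[of c] assms(1) by (smt (verit) mult_nonneg_nonneg mult_nonpos_nonneg)
  define H where "H x = - ln (d - x) / A" for x
  have step: "H x - H c \<le> t" if x: "c \<le> x" "x < d" for x
  proof -
    have "ennreal (H x - H c) \<le> travel_time f c (ereal d)"
    proof (rule travel_time_ge_increment[where h = "\<lambda>y. 1 / (A * (d - y))"])
      show "(H has_real_derivative 1 / (A * (d - y))) (at y within {c..x})" if "y \<in> {c..x}" for y
        unfolding H_def using that x A
        by (auto intro!: derivative_eq_intros simp: field_simps)
      show "1 / (A * (d - y)) \<le> 1 / f y" if "y \<in> {c<..<x}" for y
        using that x pos[of y] le[of y] A by (intro divide_left_mono) auto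
    qed (use x A in auto)
    then show ?thesis using t by simp
  qed
  \<comment> \<open>The point at which the increment of \<open>H\<close> is exactly \<open>t + 1\<close>, too much for a travel time \<open>t\<close>.\<close>
  define x where "x = d - (d - c) * exp (- A * (t + 1))"
  have "exp (- A * (t + 1)) \<le> 1" using A t by simp
  then have "(d - c) * exp (- A * (t + 1)) \<le> d - c"
    using assms(1) by (intro mult_left_le) auto
  then have "c \<le> x" by (simp add: x_def)
  moreover have "x < d" using assms(1) by (simp add: x_def)
  moreover have "H x - H c = t + 1"
  proof -
    have "ln (d - x) = ln (d - c) - A * (t + 1)"
      using assms(1) by (simp add: x_def ln_mult)
    then show ?thesis using A by (simp add: H_def field_simps)
  qed
  ultimately show False using step[of x] by simp
qed

text \<open>
  The same comparison with \<open>ln (1 + (x - c)) / A\<close>: linear growth rules out explosion.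
\<close>

lemma travel_time_linear_growth:
  fixes f :: "real \<Rightarrow> real"
  assumes pos: "\<And>x. c \<le> x \<Longrightarrow> 0 < f x"
    and le: "\<And>x. c \<le> x \<Longrightarrow> f x \<le> A * (1 + (x - c))"
  shows "travel_time f c \<infinity> = \<infinity>"
proof (rule ccontr)
  assume "travel_time f c \<infinity> \<noteq> \<infinity>"
  then obtain t where t: "travel_time f c \<infinity> = ennreal t" "0 \<le> t"
    by (cases "travel_time f c \<infinity>") auto
  have A: "0 < A" using pos[of c] le[of c] by simp
  define H where "H x = ln (1 + (x - c)) / A" for x
  have step: "H x - H c \<le> t" if x: "c \<le> x" for x
  proof -
    have "ennreal (H x - H c) \<le> travel_time f c \<infinity>"
    proof (rule travel_time_ge_increment[where h = "\<lambda>y. 1 / (A * (1 + (y - c)))"])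
      show "(H has_real_derivative 1 / (A * (1 + (y - c)))) (at y within {c..x})" if "y \<in> {c..x}" for y
        unfolding H_def using that x A
        by (auto intro!: derivative_eq_intros simp: mult.commute)
      show "1 / (A * (1 + (y - c))) \<le> 1 / f y" if "y \<in> {c<..<x}" for y
        using that x pos[of y] le[of y] A by (intro divide_left_mono) auto
    qed (use x A in auto)
    then show ?thesis using t by simp
  qed
  \<comment> \<open>Again chosen so that \<open>H\<close> grows by exactly \<open>t + 1\<close>.\<close>
  define x where "x = c + exp (A * (t + 1)) - 1"
  have "1 \<le> exp (A * (t + 1))" using A t by simp
  then have "c \<le> x" by (simp add: x_def)
  moreover have "H x - H c = t + 1"
    using A by (simp add: H_def x_def)
  ultimately show False using step[of x] by simp
qed

section \<open>Global flows and confinement of solutions\<close>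

text \<open>
  At the last visit to the starting level before going below it, the path would have to leave upwards
  and could not get below without another visit.
\<close>

lemma stays_above_start:
  fixes V :: "real \<Rightarrow> real"
  assumes cont: "continuous_on {0..t} V" and V0: "V 0 = u"
    and der: "\<And>s. s \<in> {0..t} \<Longrightarrow> V s = u \<Longrightarrow> \<exists>l>0. (V has_real_derivative l) (at s within {0..t})"
    and s: "s \<in> {0..t}"
  shows "u \<le> V s"
proof (rule ccontr)
  assume neg: "\<not> u \<le> V s"
  define Z where "Z = {r \<in> {0..s}. V r = u}"
  have conts: "continuous_on {0..s} V" using cont s by (auto intro: continuous_on_subset)
  have "compact Z"
  proof -
    have "closed Z" unfolding Z_def using conts by (intro continuous_closed_preimage_constant) auto
    then have "compact ({0..s} \<inter> Z)" by (intro compact_Int_closed) auto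
    moreover have "{0..s} \<inter> Z = Z" by (auto simp: Z_def)
    ultimately show ?thesis by simp
  qed
  moreover have "0 \<in> Z" using V0 s by (simp add: Z_def)
  ultimately obtain r where r: "r \<in> Z" "\<forall>q\<in>Z. q \<le> r"
    using compact_attains_sup[of Z] by auto
  have rs: "0 \<le> r" "r < s" "V r = u"
    using r neg by (auto simp: Z_def order_less_le)
  obtain l where "l > 0" "(V has_real_derivative l) (at r within {0..t})"
    using der[of r] rs s by auto
  from has_real_derivative_pos_inc_right[OF this(2,1)]
  obtain d where d: "d > 0" "\<And>h. h > 0 \<Longrightarrow> r + h \<in> {0..t} \<Longrightarrow> h < d \<Longrightarrow> V r < V (r + h)"
    by blast
  define h where "h = min (d / 2) (s - r)"
  have h: "h > 0" "h < d" "r + h \<le> s" using d rs by (auto simp: h_def)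
  then have "u < V (r + h)" using d(2)[of h] rs s by auto
  moreover have "continuous_on {r + h..s} V"
    using conts rs h by (auto intro: continuous_on_subset)
  ultimately obtain q where "r + h \<le> q" "q \<le> s" "V q = u"
    using IVT2'[of V s u "r + h"] neg h by auto
  then have "q \<in> Z" "r < q" using rs h by (auto simp: Z_def)
  then show False using r by fastforce
qed

text \<open>
  With \<open>G\<close> the primitive of \<open>1 / F\<close> that vanishes at \<open>u\<close>, the chain rule gives \<open>(G \<circ> V)' = 1\<close>, hence
  \<open>t = G (V t)\<close>: elapsed time is travel time. This bounds the life of every solution at once.
\<close>

lemma positive_flow_time_le:
  fixes F V :: "real \<Rightarrow> real"
  assumes t: "0 \<le> t"
    and cont: "continuous_on (V ` {0..t}) F" and pos: "\<And>x. u \<le> x \<Longrightarrow> x \<in> V ` {0..t} \<Longrightarrow> 0 < F x"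
    and V0: "V 0 = u"
    and der: "\<And>s. s \<in> {0..t} \<Longrightarrow> (V has_real_derivative F (V s)) (at s within {0..t})"
    and d: "ereal (V t) \<le> d"
  shows "ennreal t \<le> travel_time F u d"
proof -
  have contV: "continuous_on {0..t} V"
    unfolding continuous_on_eq_continuous_within by (intro ballI DERIV_continuous[OF der])
  have above: "u \<le> V s" if "s \<in> {0..t}" for s
  proof (rule stays_above_start[OF contV V0 _ that])
    show "\<exists>l>0. (V has_real_derivative l) (at r within {0..t})" if "r \<in> {0..t}" "V r = u" for r
      using der[OF that(1)] pos[of u] that by (metis imageI order_refl)
  qed
  have "compact (V ` {0..t})" using contV by (intro compact_continuous_image) auto
  moreover have "V ` {0..t} \<noteq> {}" using t by simp
  ultimately obtain b where b: "b \<in> V ` {0..t}" "\<And>x. x \<in> V ` {0..t} \<Longrightarrow> x \<le> b"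
    using compact_attains_sup by metis
  have img: "V ` {0..t} = {u..b}"
  proof
    show "V ` {0..t} \<subseteq> {u..b}" using above b by auto
    have "connected (V ` {0..t})" using contV by (intro connected_continuous_image) auto
    moreover have "u \<in> V ` {0..t}" using V0 t by (metis atLeastAtMost_iff imageI order_refl)
    ultimately show "{u..b} \<subseteq> V ` {0..t}" using b(1) connected_contains_Icc by blast
  qed
  define G where "G x = integral {u..x} (\<lambda>y. 1 / F y)" for x
  have conth: "continuous_on {u..b} (\<lambda>y. 1 / F y)"
    using cont pos unfolding img by (intro continuous_intros) (auto simp: less_imp_neq[symmetric])
  have Gder: "(G has_real_derivative 1 / F x) (at x within {u..b})" if "x \<in> {u..b}" for x
    unfolding G_def using conth that by (rule integral_has_real_derivative)
  have GV: "((\<lambda>s. G (V s)) has_real_derivative 1) (at s within {0..t})" if s: "s \<in> {0..t}" for s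
  proof -
    have Vs: "V s \<in> {u..b}" using s img by blast
    have "(G \<circ> V has_real_derivative 1 / F (V s) * F (V s)) (at s within {0..t})"
      using Gder[OF Vs] der[OF s] by (intro DERIV_image_chain) (simp_all add: img)
    moreover have "F (V s) \<noteq> 0" using pos[of "V s"] Vs s by (auto simp: less_imp_neq[symmetric])
    ultimately show ?thesis by (simp add: comp_def)
  qed
  have "((\<lambda>s. 1) has_integral G (V t) - G (V 0)) {0..t}"
    using t GV by (intro fundamental_theorem_of_calculus)
      (auto simp: has_real_derivative_iff_has_vector_derivative)
  then have "t = G (V t) - G u"
    using has_integral_const_real[of "1::real" 0 t] t V0 by (auto dest: has_integral_unique)
  moreover have "ennreal (G (V t) - G u) \<le> travel_time F u d"
  proof (rule travel_time_ge_increment[OF _ d, where h = "\<lambda>y. 1 / F y"])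
    have Vt: "V t \<in> {u..b}" using t img by force
    then show "u \<le> V t" by simp
    fix y assume y: "y \<in> {u..V t}"
    then have yb: "y \<in> {u..b}" using Vt by auto
    show "(G has_real_derivative 1 / F y) (at y within {u..V t})"
      using Gder[OF yb] Vt by (auto intro: DERIV_subset)
    show "0 \<le> 1 / F y" using pos[of y] yb img by (auto intro: less_imp_le)
  qed auto
  ultimately show ?thesis by simp
qed

text \<open>
  A zero of \<open>F\<close> that the flow approaches is a barrier of infinite travel time, because convexity
  bounds the speed by a multiple of the distance to the zero. From below, the bound is the chord from
  \<open>u\<close> to the zero. From above, it is the chord through the zero and a point to its left, which
  bounds a convex function from below on the other side. If there is no zero below, the
  affine minorant limits the speed of the descent. The condition \<open>turn\<close> excludes the remaining case of a flow that
  increases without meeting a zero.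
\<close>

lemma convex_flow_global:
  fixes F :: "real \<Rightarrow> real"
  assumes down: "\<And>x y. y \<in> D \<Longrightarrow> x \<le> y \<Longrightarrow> x \<in> D"
    and cont: "continuous_on D F" and conv: "convex_on D F"
    and affine: "\<And>x. x \<in> D \<Longrightarrow> k * x + e \<le> F x"
    and u: "u \<in> D" and turn: "\<exists>b\<in>D. u \<le> b \<and> F b \<le> 0"
  obtains V where "V 0 = u" and "\<And>t. 0 \<le> t \<Longrightarrow> V t \<in> D \<and> (V has_real_derivative F (V t)) (at t)"
proof -
  have sub: "{a..b} \<subseteq> D" if "b \<in> D" for a b using down that by auto
  have contI: "continuous_on {a..b} F" if "b \<in> D" for a b
    using cont sub[OF that] by (rule continuous_on_subset)
  have convI: "convex_on {a..b} F" if "b \<in> D" for a b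
    using conv sub[OF that] by (rule convex_on_subset) simp
  have compZ: "compact {x \<in> {a..b}. F x = 0}" if "b \<in> D" for a b
  proof -
    have "closed {x \<in> {a..b}. F x = 0}"
      using contI[OF that] by (intro continuous_closed_preimage_constant) auto
    then have "compact ({a..b} \<inter> {x \<in> {a..b}. F x = 0})" by (intro compact_Int_closed) auto
    moreover have "{a..b} \<inter> {x \<in> {a..b}. F x = 0} = {x \<in> {a..b}. F x = 0}" by auto
    ultimately show ?thesis by simp
  qed
  consider "F u = 0" | "F u > 0" | "F u < 0" by linarith
  then show ?thesis
  proof cases
    case 1
    then show ?thesis using u by (intro that[of "\<lambda>_. u"]) auto
  next
    case 2
    then obtain b where b: "b \<in> D" "u \<le> b" "F b \<le> 0" using turn by blast
    define Z where "Z = {x \<in> {u..b}. F x = 0}"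
    have "Z \<noteq> {}" using IVT2'[of F b 0 u] 2 b contI[OF b(1)] by (auto simp: Z_def)
    moreover have "compact Z" unfolding Z_def by (rule compZ[OF b(1)])
    ultimately obtain r where r: "r \<in> Z" "\<And>x. x \<in> Z \<Longrightarrow> r \<le> x"
      using compact_attains_inf[of Z] by blast
    then have rD: "r \<in> D" "F r = 0" "u < r" "r \<le> b"
      using down[OF b(1), of r] 2 by (auto simp: Z_def order_less_le)
    have pos: "0 < F x" if x: "u \<le> x" "ereal x < ereal r" for x
    proof (rule ccontr)
      assume "\<not> 0 < F x"
      then obtain y where "u \<le> y" "y \<le> x" "F y = 0"
        using IVT2'[of F x 0 u] 2 x contI[of x u] down[OF rD(1), of x] by auto
      then have "y \<in> Z" using x rD by (auto simp: Z_def)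
      then show False using r(2)[of y] \<open>y \<le> x\<close> x by auto
    qed
    have "travel_time F u (ereal r) = \<infinity>"
    proof (rule travel_time_barrier[where A = "F u / (r - u)"])
      fix x assume x: "u \<le> x" "x < r"
      then have "F x \<le> (F r - F u) / (r - u) * (x - u) + F u"
        using convex_onD_Icc'[OF convI[OF rD(1), of u], of x] by simp
      also have "\<dots> = F u / (r - u) * (r - x)"
        using rD by (simp add: field_simps)
      finally show "F x \<le> F u / (r - u) * (r - x)" .
    qed (use pos rD in auto)
    moreover have "continuous_on {x. u \<le> x \<and> ereal x < ereal r} F"
      using contI[OF rD(1), of u] by (rule continuous_on_subset) auto
    ultimately obtain V where V: "V 0 = u"
        "\<And>t. 0 \<le> t \<Longrightarrow> u \<le> V t \<and> ereal (V t) < ereal r \<and> (V has_real_derivative F (V t)) (at t)"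
      using increasing_flow_exists[of u "ereal r" F] pos rD(3) by (auto simp: less_top[symmetric])
    then show ?thesis using down[OF rD(1)] by (intro that[of V]) (auto simp: less_imp_le)
  next
    case 3
    \<comment> \<open>Downward motion is turned into upward motion by the reflection \<open>w = - x\<close>.\<close>
    define g where "g w = - F (- w)" for w
    have "\<exists>d. ereal (- u) < d \<and> (\<forall>w. - u \<le> w \<longrightarrow> ereal w < d \<longrightarrow> 0 < g w)
        \<and> travel_time g (- u) d = \<infinity>"
    proof (cases "\<exists>z\<le>u. F z = 0")
      case True
      then obtain z where z: "z \<le> u" "F z = 0" by blast
      define Z where "Z = {x \<in> {z..u}. F x = 0}"
      have "Z \<noteq> {}" using z by (auto simp: Z_def)
      moreover have "compact Z" unfolding Z_def by (rule compZ[OF u])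
      ultimately obtain r where r: "r \<in> Z" "\<And>x. x \<in> Z \<Longrightarrow> x \<le> r"
        using compact_attains_sup[of Z] by blast
      then have rD: "F r = 0" "r < u" "z \<le> r"
        using 3 by (auto simp: Z_def order_less_le)
      have neg: "F x < 0" if x: "r < x" "x \<le> u" for x
      proof (rule ccontr)
        assume "\<not> F x < 0"
        then obtain y where "x \<le> y" "y \<le> u" "F y = 0"
          using IVT2'[of F u 0 x] 3 x contI[OF u, of x] by auto
        then have "y \<in> Z" using x rD by (auto simp: Z_def)
        then show False using r(2)[of y] \<open>x \<le> y\<close> x by auto
      qed
      have "travel_time g (- u) (ereal (- r)) = \<infinity>"
      \<comment> \<open>Since \<open>F r = 0\<close>, \<open>F (r - 1)\<close> is minus the slope of the chord over \<open>[r - 1, r]\<close>.\<close>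
      proof (rule travel_time_barrier[where A = "F (r - 1)"])
        fix w assume w: "- u \<le> w" "w < - r"
        then have xD: "- w \<in> D" "r < - w" using down[OF u, of "- w"] by auto
        have "F r \<le> (F (- w) - F (r - 1)) / (- w - (r - 1)) * (r - (r - 1)) + F (r - 1)"
          using convex_onD_Icc'[OF convI[OF xD(1), of "r - 1"], of r] xD by simp
        then have "0 \<le> F (- w) + F (r - 1) * (- w - r)"
          using rD xD by (simp add: field_simps)
        then show "g w \<le> F (r - 1) * (- r - w)" by (simp add: g_def algebra_simps)
      qed (use neg rD in \<open>auto simp: g_def\<close>)
      then show ?thesis using neg rD by (intro exI[of _ "ereal (- r)"]) (auto simp: g_def)
    next
      case False
      have neg: "F x < 0" if x: "x \<le> u" for x
        using IVT2'[of F u 0 x] 3 x contI[OF u, of x] False by force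
      have "travel_time g (- u) \<infinity> = \<infinity>"
      proof (rule travel_time_linear_growth[where A = "\<bar>k\<bar> + \<bar>k * u + e\<bar>"])
        fix w assume w: "- u \<le> w"
        then have "k * (- w) + e \<le> F (- w)" using affine[of "- w"] down[OF u, of "- w"] by simp
        then have "g w \<le> k * (w + u) - (k * u + e)" by (simp add: g_def algebra_simps)
        also have "\<dots> \<le> \<bar>k\<bar> * (w + u) + \<bar>k * u + e\<bar>"
          using mult_right_mono[of k "\<bar>k\<bar>" "w + u"] w by linarith
        also have "\<dots> \<le> (\<bar>k\<bar> + \<bar>k * u + e\<bar>) * (1 + (w - - u))"
          using w mult_nonneg_nonneg[of "\<bar>k * u + e\<bar>" "w + u"] by (simp add: distrib_left distrib_right)
        finally show "g w \<le> (\<bar>k\<bar> + \<bar>k * u + e\<bar>) * (1 + (w - - u))" .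
      qed (use neg in \<open>auto simp: g_def\<close>)
      then show ?thesis using neg by (intro exI[of _ \<infinity>]) (auto simp: g_def)
    qed
    then obtain d where d: "ereal (- u) < d"
      "\<And>w. - u \<le> w \<Longrightarrow> ereal w < d \<Longrightarrow> 0 < g w" "travel_time g (- u) d = \<infinity>" by blast
    have "continuous_on {x. - u \<le> x \<and> ereal x < d} g"
      unfolding g_def using down[OF u]
      by (intro continuous_on_minus continuous_on_compose2[OF cont]) (auto intro!: continuous_intros)
    from increasing_flow_exists[OF d(1) this d(2)]
    obtain W where "W 0 = - u" and "\<And>t. 0 \<le> t \<Longrightarrow> ennreal t < travel_time g (- u) d \<Longrightarrow>
        - u \<le> W t \<and> ereal (W t) < d \<and> (W has_real_derivative g (W t)) (at t)" by metis
    then have W: "W 0 = - u"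
      "\<And>t. 0 \<le> t \<Longrightarrow> - u \<le> W t \<and> (W has_real_derivative g (W t)) (at t)"
      using d(3) by auto
    have "- W t \<in> D \<and> ((\<lambda>t. - W t) has_real_derivative F (- W t)) (at t)" if "0 \<le> t" for t
      using W(2)[OF that] down[OF u, of "- W t"] by (auto simp: g_def dest: DERIV_minus)
    then show ?thesis using W(1) by (intro that[of "\<lambda>t. - W t"]) auto
  qed
qed

section \<open>Integrability of the jump integrands\<close>

lemma ext_integral_eq_integral:
  assumes "integrable m f"
  shows "ext_integral m f = ereal (integral\<^sup>L m f)"
proof -
  have "(\<integral>\<^sup>+x. ennreal (f x) \<partial>m) < \<infinity>" "(\<integral>\<^sup>+x. ennreal (- f x) \<partial>m) < \<infinity>"
    using assms integrableD(2,3)[OF assms] by (auto simp: top.not_eq_extremum)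
  then show ?thesis
    unfolding ext_integral_def real_lebesgue_integral_def[OF assms]
    by (cases "\<integral>\<^sup>+x. ennreal (f x) \<partial>m"; cases "\<integral>\<^sup>+x. ennreal (- f x) \<partial>m") auto
qed

text \<open>
  A value below \<open>\<infinity>\<close> forces the positive part to have a finite integral, since \<open>\<infinity> - \<infinity> = \<infinity>\<close> in
  \<open>ereal\<close>. This is how exponential moments are recovered from finiteness of \<open>\<Psi>\<close> and \<open>\<Phi>\<close>.
\<close>

lemma ext_integral_finite_imp:
  assumes "ext_integral m f < \<infinity>"
  shows "(\<integral>\<^sup>+x. ennreal (f x) \<partial>m) < \<infinity>"
proof (rule ccontr)
  assume "\<not> ?thesis"
  then have "(\<integral>\<^sup>+x. ennreal (f x) \<partial>m) = \<infinity>" by (simp add: not_less top_unique)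
  then show False
    using assms unfolding ext_integral_def by (simp add: infinity_ennreal_def)
qed

lemma abs_exp_minus_one_le:
  fixes u x :: real
  assumes "\<bar>x\<bar> \<le> 1"
  shows "\<bar>exp (u * x) - 1\<bar> \<le> exp \<bar>u\<bar> * \<bar>u\<bar> * \<bar>x\<bar>"
proof -
  obtain t where t: "\<bar>t\<bar> \<le> \<bar>u * x\<bar>" "exp (u * x) = (\<Sum>m<1. (u * x) ^ m / fact m) + exp t / fact 1 * (u * x) ^ 1"
    using Maclaurin_exp_le by blast
  have "\<bar>u * x\<bar> \<le> \<bar>u\<bar>" using assms by (simp add: abs_mult mult_left_le)
  then have "t \<le> \<bar>u\<bar>" using t(1) by simp
  then have "exp t * \<bar>u * x\<bar> \<le> exp \<bar>u\<bar> * \<bar>u * x\<bar>" by (intro mult_right_mono) auto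
  moreover have "\<bar>exp (u * x) - 1\<bar> = exp t * \<bar>u * x\<bar>" using t(2) by (simp add: abs_mult)
  ultimately show ?thesis by (simp add: abs_mult mult.assoc)
qed

lemma abs_exp_minus_linear_le:
  fixes u x :: real
  assumes "\<bar>x\<bar> \<le> 1"
  shows "\<bar>exp (u * x) - 1 - u * x\<bar> \<le> exp \<bar>u\<bar> * u\<^sup>2 * x\<^sup>2"
proof -
  obtain t where t: "\<bar>t\<bar> \<le> \<bar>u * x\<bar>" "exp (u * x) = (\<Sum>m<2. (u * x) ^ m / fact m) + exp t / fact 2 * (u * x) ^ 2"
    using Maclaurin_exp_le by blast
  have "\<bar>u * x\<bar> \<le> \<bar>u\<bar>" using assms by (simp add: abs_mult mult_left_le)
  then have "t \<le> \<bar>u\<bar>" using t(1) by simp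
  then have "exp t * (u * x)\<^sup>2 \<le> exp \<bar>u\<bar> * (u * x)\<^sup>2" by (intro mult_right_mono) auto
  moreover have "\<bar>exp (u * x) - 1 - u * x\<bar> = exp t * (u * x)\<^sup>2 / 2"
    using t(2) by (simp add: numeral_2_eq_2)
  moreover have "0 \<le> exp t * (u * x)\<^sup>2" by simp
  ultimately have "\<bar>exp (u * x) - 1 - u * x\<bar> \<le> exp \<bar>u\<bar> * (u * x)\<^sup>2" by linarith
  then show ?thesis by (simp add: power_mult_distrib mult.assoc)
qed

lemma levy_measure_finite_far:
  assumes "levy_measure m"
  shows "emeasure m {z. 1 \<le> \<bar>z\<bar>} < \<infinity>"
proof -
  have [measurable_cong]: "sets m = sets borel" using assms by (simp add: levy_measure_def)
  have "emeasure m {z. 1 \<le> \<bar>z\<bar>} = (\<integral>\<^sup>+x. indicator {z. 1 \<le> \<bar>z\<bar>} x \<partial>m)"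
    by (intro nn_integral_indicator[symmetric]) measurable
  also have "\<dots> \<le> (\<integral>\<^sup>+x. ennreal (min 1 (x\<^sup>2)) \<partial>m)"
  proof (rule nn_integral_mono)
    fix x :: real
    have "1 \<le> \<bar>x\<bar> \<Longrightarrow> 1 \<le> x\<^sup>2" by (simp add: abs_le_square_iff[of 1 x, simplified])
    then show "(indicator {z. 1 \<le> \<bar>z\<bar>} x :: ennreal) \<le> ennreal (min 1 (x\<^sup>2))"
      by (auto simp: indicator_def min_def)
  qed
  also have "\<dots> < \<infinity>" using assms by (simp add: levy_measure_def)
  finally show ?thesis .
qed

lemma levy_measure_nonneg_AE_pos:
  assumes "levy_measure_nonneg m"
  shows "AE x in m. 0 < x"
proof -
  have [measurable_cong]: "sets m = sets borel"
    using assms by (simp add: levy_measure_nonneg_def levy_measure_def)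
  have "{..<0} \<in> null_sets m" "{0} \<in> null_sets m"
    using assms by (auto simp: levy_measure_nonneg_def levy_measure_def null_sets_def)
  then have "AE x in m. x \<notin> {..<0}" "AE x in m. x \<notin> {0}"
    by (metis AE_not_in)+
  then show ?thesis by eventually_elim auto
qed

text \<open>
  The three exponents are handled alike: \<open>g\<close> is integrable by the condition on the small jumps, and
  \<open>h\<close> by the exponential moments together with the mass or the mean of the large jumps.
\<close>

lemma integrable_by_pieces:
  fixes f g h :: "real \<Rightarrow> real"
  assumes m: "sets m = sets borel"
    and [measurable]: "f \<in> borel_measurable borel" "g \<in> borel_measurable borel"
      "h \<in> borel_measurable borel"
    and g: "(\<integral>\<^sup>+x. ennreal (g x) \<partial>m) < \<infinity>" and h: "(\<integral>\<^sup>+x. ennreal (h x) \<partial>m) < \<infinity>"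
    and le: "AE x in m. \<bar>f x\<bar> \<le> \<bar>C\<bar> * g x + h x \<and> 0 \<le> g x \<and> 0 \<le> h x"
  shows "integrable m f"
proof (rule integrableI_bounded)
  have [measurable_cong]: "sets m = sets borel" by fact
  show "f \<in> borel_measurable m" by measurable
  have "(\<integral>\<^sup>+x. ennreal (norm (f x)) \<partial>m) \<le> (\<integral>\<^sup>+x. ennreal \<bar>C\<bar> * ennreal (g x) + ennreal (h x) \<partial>m)"
  proof (rule nn_integral_mono_AE)
    show "AE x in m. ennreal (norm (f x)) \<le> ennreal \<bar>C\<bar> * ennreal (g x) + ennreal (h x)"
      using le by eventually_elim (simp flip: ennreal_mult' ennreal_plus)
  qed
  also have "\<dots> = ennreal \<bar>C\<bar> * (\<integral>\<^sup>+x. ennreal (g x) \<partial>m) + (\<integral>\<^sup>+x. ennreal (h x) \<partial>m)"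
    by (simp add: nn_integral_add nn_integral_cmult)
  also have "\<dots> < \<infinity>" using g h by (simp add: ennreal_mult_less_top)
  finally show "(\<integral>\<^sup>+x. ennreal (norm (f x)) \<partial>m) < \<infinity>" .
qed

lemma Psi_integrable:
  assumes m: "levy_measure_nonneg m" and small: "(\<integral>\<^sup>+x\<in>{0..1}. ennreal x \<partial>m) < \<infinity>"
    and big: "(\<integral>\<^sup>+x\<in>{1..}. ennreal (exp (u * x)) \<partial>m) < \<infinity>"
  shows "integrable m (\<lambda>x. exp (u * x) - 1)"
proof (rule integrable_by_pieces[where C = "exp \<bar>u\<bar> * \<bar>u\<bar>" and g = "\<lambda>x. x * indicator {0..1} x"
      and h = "\<lambda>x. exp (u * x) * indicator {1..} x + indicator {z. 1 \<le> \<bar>z\<bar>} x"])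
  show sets: "sets m = sets borel" using m by (simp add: levy_measure_nonneg_def levy_measure_def)
  note [measurable_cong] = sets
  show "(\<integral>\<^sup>+x. ennreal (x * indicator {0..1} x) \<partial>m) < \<infinity>"
    using small by (simp add: ennreal_mult'' ennreal_indicator)
  have "(\<integral>\<^sup>+x. ennreal (exp (u * x) * indicator {1..} x + indicator {z. 1 \<le> \<bar>z\<bar>} x) \<partial>m)
     = (\<integral>\<^sup>+x. ennreal (exp (u * x)) * indicator {1..} x + indicator {z. 1 \<le> \<bar>z\<bar>} x \<partial>m)"
    by (intro nn_integral_cong) (auto simp: indicator_def)
  also have "\<dots> = (\<integral>\<^sup>+x\<in>{1..}. ennreal (exp (u * x)) \<partial>m) + emeasure m {z. 1 \<le> \<bar>z\<bar>}"
    by (subst nn_integral_add) (auto simp: nn_integral_indicator)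
  also have "\<dots> < \<infinity>"
    using big levy_measure_finite_far m by (simp add: levy_measure_nonneg_def)
  finally show "(\<integral>\<^sup>+x. ennreal (exp (u * x) * indicator {1..} x + indicator {z. 1 \<le> \<bar>z\<bar>} x) \<partial>m) < \<infinity>" .
  show "AE x in m. \<bar>exp (u * x) - 1\<bar> \<le> \<bar>exp \<bar>u\<bar> * \<bar>u\<bar>\<bar> * (x * indicator {0..1} x) +
      (exp (u * x) * indicator {1..} x + indicator {z. 1 \<le> \<bar>z\<bar>} x) \<and> 0 \<le> x * indicator {0..1} x
      \<and> 0 \<le> exp (u * x) * indicator {1..} x + indicator {z. 1 \<le> \<bar>z\<bar>} x"
    using levy_measure_nonneg_AE_pos[OF m]
  proof eventually_elim
    case (elim x)
    consider "x < 1" | "1 \<le> x" by linarith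
    then show ?case
    proof cases
      case 1
      then show ?thesis using elim abs_exp_minus_one_le[of x u] by simp
    next
      case 2
      have "\<bar>exp (u * x) - 1\<bar> \<le> exp (u * x) + 1" using exp_gt_zero[of "u * x"] by linarith
      then show ?thesis using 2 by (auto simp: indicator_def intro: add_increasing)
    qed
  qed
qed measurable

lemma Phi_integrable:
  assumes m: "levy_measure_nonneg m" and mean: "(\<integral>\<^sup>+x\<in>{1..}. ennreal x \<partial>m) < \<infinity>"
    and big: "(\<integral>\<^sup>+x\<in>{1..}. ennreal (exp (u * x)) \<partial>m) < \<infinity>"
  shows "integrable m (\<lambda>x. exp (u * x) - 1 - u * x)"
proof (rule integrable_by_pieces[where C = "exp \<bar>u\<bar> * u\<^sup>2" and g = "\<lambda>x. min 1 (x\<^sup>2)"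
      and h = "\<lambda>x. exp (u * x) * indicator {1..} x + \<bar>u\<bar> * (x * indicator {1..} x)"])
  show sets: "sets m = sets borel" using m by (simp add: levy_measure_nonneg_def levy_measure_def)
  note [measurable_cong] = sets
  show "(\<integral>\<^sup>+x. ennreal (min 1 (x\<^sup>2)) \<partial>m) < \<infinity>"
    using m by (simp add: levy_measure_nonneg_def levy_measure_def)
  have "(\<integral>\<^sup>+x. ennreal (exp (u * x) * indicator {1..} x + \<bar>u\<bar> * (x * indicator {1..} x)) \<partial>m)
     = (\<integral>\<^sup>+x. ennreal (exp (u * x)) * indicator {1..} x + ennreal \<bar>u\<bar> * (ennreal x * indicator {1..} x) \<partial>m)"
    by (intro nn_integral_cong) (auto simp: indicator_def ennreal_plus ennreal_mult)
  also have "\<dots> = (\<integral>\<^sup>+x\<in>{1..}. ennreal (exp (u * x)) \<partial>m) + ennreal \<bar>u\<bar> * (\<integral>\<^sup>+x\<in>{1..}. ennreal x \<partial>m)"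
    by (subst nn_integral_add) (auto simp: nn_integral_cmult)
  also have "\<dots> < \<infinity>"
    using big mean by (simp add: ennreal_mult_less_top)
  finally show "(\<integral>\<^sup>+x. ennreal (exp (u * x) * indicator {1..} x + \<bar>u\<bar> * (x * indicator {1..} x)) \<partial>m) < \<infinity>" .
  show "AE x in m. \<bar>exp (u * x) - 1 - u * x\<bar> \<le> \<bar>exp \<bar>u\<bar> * u\<^sup>2\<bar> * min 1 (x\<^sup>2) +
      (exp (u * x) * indicator {1..} x + \<bar>u\<bar> * (x * indicator {1..} x)) \<and> 0 \<le> min 1 (x\<^sup>2)
      \<and> 0 \<le> exp (u * x) * indicator {1..} x + \<bar>u\<bar> * (x * indicator {1..} x)"
    using levy_measure_nonneg_AE_pos[OF m]
  proof eventually_elim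
    case (elim x)
    consider "x < 1" | "1 \<le> x" by linarith
    then show ?case
    proof cases
      case 1
      then have "x\<^sup>2 \<le> 1" using elim by (simp add: power_le_one)
      then show ?thesis using 1 elim abs_exp_minus_linear_le[of x u] by simp
    next
      case 2
      have "0 \<le> exp (u * x) - 1 - u * x" using exp_ge_add_one_self[of "u * x"] by linarith
      moreover have "- (u * x) \<le> \<bar>u\<bar> * x" using 2 by (simp add: abs_if mult_nonneg_nonneg)
      moreover have "0 \<le> \<bar>u\<bar> * x" "0 \<le> exp \<bar>u\<bar> * u\<^sup>2 * min 1 (x\<^sup>2)" using 2 by auto
      ultimately have "\<bar>exp (u * x) - 1 - u * x\<bar>
          \<le> exp \<bar>u\<bar> * u\<^sup>2 * min 1 (x\<^sup>2) + (exp (u * x) + \<bar>u\<bar> * x)" by linarith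
      then show ?thesis using 2 by (simp add: add_nonneg_nonneg)
    qed
  qed
qed measurable

lemma Xi_integrable:
  assumes m: "levy_measure m"
    and big: "(\<integral>\<^sup>+z\<in>{z. 1 \<le> \<bar>z\<bar>}. ennreal (exp (u * z)) \<partial>m) < \<infinity>"
  shows "integrable m (\<lambda>z. exp (u * z) - 1 - (if \<bar>z\<bar> < 1 then u * z else 0))"
proof (rule integrable_by_pieces[where C = "exp \<bar>u\<bar> * u\<^sup>2 + 1" and g = "\<lambda>x. min 1 (x\<^sup>2)"
      and h = "\<lambda>z. exp (u * z) * indicator {z. 1 \<le> \<bar>z\<bar>} z"])
  show sets: "sets m = sets borel" using m by (simp add: levy_measure_def)
  note [measurable_cong] = sets
  show "(\<integral>\<^sup>+x. ennreal (min 1 (x\<^sup>2)) \<partial>m) < \<infinity>"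
    using m by (simp add: levy_measure_def)
  show "(\<integral>\<^sup>+z. ennreal (exp (u * z) * indicator {z. 1 \<le> \<bar>z\<bar>} z) \<partial>m) < \<infinity>"
    using big by (simp add: ennreal_mult'' ennreal_indicator)
  show "AE z in m. \<bar>exp (u * z) - 1 - (if \<bar>z\<bar> < 1 then u * z else 0)\<bar>
      \<le> \<bar>exp \<bar>u\<bar> * u\<^sup>2 + 1\<bar> * min 1 (z\<^sup>2) + exp (u * z) * indicator {z. 1 \<le> \<bar>z\<bar>} z
      \<and> 0 \<le> min 1 (z\<^sup>2) \<and> 0 \<le> exp (u * z) * indicator {z. 1 \<le> \<bar>z\<bar>} z"
  proof (rule AE_I2)
    fix z :: real
    consider "\<bar>z\<bar> < 1" | "1 \<le> \<bar>z\<bar>" by linarith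
    then show "\<bar>exp (u * z) - 1 - (if \<bar>z\<bar> < 1 then u * z else 0)\<bar>
      \<le> \<bar>exp \<bar>u\<bar> * u\<^sup>2 + 1\<bar> * min 1 (z\<^sup>2) + exp (u * z) * indicator {z. 1 \<le> \<bar>z\<bar>} z
      \<and> 0 \<le> min 1 (z\<^sup>2) \<and> 0 \<le> exp (u * z) * indicator {z. 1 \<le> \<bar>z\<bar>} z"
    proof cases
      case 1
      then have "z\<^sup>2 \<le> 1" by (simp add: abs_square_le_1)
      moreover have "\<bar>exp (u * z) - 1 - u * z\<bar> \<le> exp \<bar>u\<bar> * u\<^sup>2 * z\<^sup>2"
        using 1 by (intro abs_exp_minus_linear_le) simp
      ultimately show ?thesis using 1 by (simp add: distrib_right add_increasing2)
    next
      case 2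
      then have "1 \<le> z\<^sup>2" using abs_le_square_iff[of 1 z] by simp
      moreover have "\<bar>exp (u * z) - 1\<bar> \<le> exp (u * z) + 1"
        using exp_gt_zero[of "u * z"] by linarith
      moreover have "0 \<le> exp \<bar>u\<bar> * u\<^sup>2" by simp
      ultimately have "\<bar>exp (u * z) - 1\<bar> \<le> (exp \<bar>u\<bar> * u\<^sup>2 + 1) + exp (u * z)" by linarith
      then show ?thesis using 2 \<open>1 \<le> z\<^sup>2\<close> by simp
    qed
  qed
qed measurable

section \<open>The domain of exponential moments\<close>

abbreviation exp_moment :: "real measure \<Rightarrow> real \<Rightarrow> ennreal" where
  "exp_moment m u \<equiv> \<integral>\<^sup>+x\<in>{1..}. ennreal (exp (u * x)) \<partial>m"

lemma exp_moment_mono: "u \<le> v \<Longrightarrow> exp_moment m u \<le> exp_moment m v"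
  by (intro nn_integral_mono) (auto simp: indicator_def intro!: ennreal_leI mult_right_mono)

lemma emeasure_ge_one_finite:
  assumes "levy_measure m"
  shows "emeasure m {1..} < \<infinity>"
proof -
  have "emeasure m {1..} \<le> emeasure m {z. 1 \<le> \<bar>z\<bar>}"
    using assms by (intro emeasure_mono) (auto simp: levy_measure_def)
  then show ?thesis using levy_measure_finite_far[OF assms] by (rule le_less_trans)
qed

lemma exp_moment_zero_finite:
  assumes "levy_measure m"
  shows "exp_moment m 0 < \<infinity>"
  using emeasure_ge_one_finite[OF assms] assms
  by (simp add: levy_measure_def)

lemma D_X_iff: "u \<in> D_X p \<longleftrightarrow> exp_moment (levy_nu p) u < \<infinity> \<and> exp_moment (levy_pi p) u < \<infinity>"
  by (simp add: D_X_def)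

lemma D_X_downward_closed: "v \<in> D_X p \<Longrightarrow> u \<le> v \<Longrightarrow> u \<in> D_X p"
  unfolding D_X_iff using exp_moment_mono le_less_trans by blast

lemma zero_in_D_X: "admissible p \<Longrightarrow> 0 \<in> D_X p"
  unfolding D_X_iff using exp_moment_zero_finite
  by (auto simp: admissible_def levy_measure_nonneg_def)

lemma Psi_eq:
  assumes "admissible p" "u \<in> D_X p"
  shows "Psi p u = ereal (beta p * u + (LINT x|levy_nu p. exp (u * x) - 1))"
  using assms Psi_integrable[of "levy_nu p" u]
  by (simp add: Psi_def ext_integral_eq_integral admissible_def D_X_iff)

lemma Phi_eq:
  assumes "admissible p" "u \<in> D_X p"
  shows "Phi p u = ereal (- b_X p * u + 1 / 2 * (sigma_X p)\<^sup>2 * u\<^sup>2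
    + (LINT x|levy_pi p. exp (u * x) - 1 - u * x))"
  using assms Phi_integrable[of "levy_pi p" u]
  by (simp add: Phi_def ext_integral_eq_integral admissible_def D_X_iff)

lemma Xi_finite:
  assumes "admissible p" "u \<in> D_Z p"
  obtains k where "Xi p u = ereal k"
  using assms Xi_integrable[of "levy_gamma p" u]
  by (simp add: Xi_def ext_integral_eq_integral admissible_def D_Z_def)

text \<open>
  On \<open>[1, \<infinity>)\<close> the exponential exceeds the integrand by \<open>1\<close>, which has finite mass there.
\<close>

lemma exp_moment_finite_of_Psi:
  assumes "levy_measure m" "ext_integral m (\<lambda>x. exp (u * x) - 1) < \<infinity>"
  shows "exp_moment m u < \<infinity>"
proof -
  have [measurable_cong]: "sets m = sets borel" using assms by (simp add: levy_measure_def)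
  have "exp_moment m u \<le> (\<integral>\<^sup>+x. ennreal (exp (u * x) - 1) + indicator {1..} x \<partial>m)"
  proof (rule nn_integral_mono)
    fix x :: real
    have "ennreal (exp (u * x)) \<le> ennreal (exp (u * x) - 1) + 1"
    proof (cases "1 \<le> exp (u * x)")
      case True
      then show ?thesis by (simp flip: ennreal_plus ennreal_1)
    next
      case False
      then have "ennreal (exp (u * x)) \<le> 1" by (subst ennreal_1[symmetric], intro ennreal_leI) simp
      then show ?thesis by (simp add: add_increasing)
    qed
    then show "ennreal (exp (u * x)) * indicator {1..} x
        \<le> ennreal (exp (u * x) - 1) + indicator {1..} x"
      by (auto simp: indicator_def)
  qed
  also have "\<dots> = (\<integral>\<^sup>+x. ennreal (exp (u * x) - 1) \<partial>m) + emeasure m {1..}"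
    by (subst nn_integral_add) auto
  also have "\<dots> < \<infinity>"
    using ext_integral_finite_imp[OF assms(2)] emeasure_ge_one_finite[OF assms(1)] by simp
  finally show ?thesis .
qed

text \<open>
  On \<open>[1, \<infinity>)\<close> the exponential exceeds the integrand by \<open>1 + u x\<close>, integrable there by the
  finite-mean condition.
\<close>

lemma exp_moment_finite_of_Phi:
  assumes "levy_measure m" "(\<integral>\<^sup>+x\<in>{1..}. ennreal x \<partial>m) < \<infinity>"
    and "0 \<le> u" "ext_integral m (\<lambda>x. exp (u * x) - 1 - u * x) < \<infinity>"
  shows "exp_moment m u < \<infinity>"
proof -
  have [measurable_cong]: "sets m = sets borel" using assms by (simp add: levy_measure_def)
  have "exp_moment m u \<le> (\<integral>\<^sup>+x. ennreal (exp (u * x) - 1 - u * x)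
      + (indicator {1..} x + ennreal u * (ennreal x * indicator {1..} x)) \<partial>m)"
  proof (rule nn_integral_mono)
    fix x :: real
    show "ennreal (exp (u * x)) * indicator {1..} x \<le> ennreal (exp (u * x) - 1 - u * x)
      + (indicator {1..} x + ennreal u * (ennreal x * indicator {1..} x))"
    proof (cases "1 \<le> x")
      case True
      have "0 \<le> exp (u * x) - 1 - u * x" using exp_ge_add_one_self[of "u * x"] by linarith
      moreover have "0 \<le> u * x" using True assms(3) by simp
      ultimately have "ennreal (exp (u * x) - 1 - u * x) + (1 + ennreal u * ennreal x)
          = ennreal (exp (u * x))"
        using assms(3) True by (simp flip: ennreal_mult ennreal_plus ennreal_1)
      then show ?thesis using True by simp
    qed simp
  qed
  also have "\<dots> = (\<integral>\<^sup>+x. ennreal (exp (u * x) - 1 - u * x) \<partial>m)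
      + (emeasure m {1..} + ennreal u * (\<integral>\<^sup>+x\<in>{1..}. ennreal x \<partial>m))"
    by (simp add: nn_integral_add nn_integral_cmult)
  also have "\<dots> < \<infinity>"
    using ext_integral_finite_imp[OF assms(4)] emeasure_ge_one_finite[OF assms(1)] assms(2)
    by (simp add: ennreal_mult_less_top)
  finally show ?thesis .
qed

text \<open>
  Together with the next lemma: \<open>D_X\<close> is an interval unbounded to the left whose supremum is
  \<open>min \<psi> \<phi>\<close>, which may or may not belong to it.
\<close>

lemma less_min_psi_phi_imp_D_X:
  assumes p: "admissible p" and x: "ereal x < min (psi_sup p) (phi_sup p)"
  shows "x \<in> D_X p"
proof -
  obtain y where y: "x < y" "0 \<le> y" "Psi p y < \<infinity>"
    using x by (auto simp: psi_sup_def less_Sup_iff)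
  obtain z where z: "x < z" "0 \<le> z" "Phi p z < \<infinity>"
    using x by (auto simp: phi_sup_def less_Sup_iff)
  have "exp_moment (levy_nu p) y < \<infinity>"
    using y p by (intro exp_moment_finite_of_Psi)
      (auto simp: admissible_def levy_measure_nonneg_def Psi_def)
  moreover have "exp_moment (levy_pi p) z < \<infinity>"
    using z p by (intro exp_moment_finite_of_Phi)
      (auto simp: admissible_def levy_measure_nonneg_def Phi_def)
  ultimately show ?thesis
    unfolding D_X_iff using exp_moment_mono y(1) z(1) by (meson le_less_trans less_imp_le)
qed

lemma D_X_le_min_psi_phi:
  assumes p: "admissible p" and x: "x \<in> D_X p"
  shows "ereal x \<le> min (psi_sup p) (phi_sup p)"
proof -
  \<comment> \<open>\<open>\<psi>\<close> and \<open>\<phi>\<close> are suprema over nonnegative arguments only, so negative \<open>x\<close> are compared through \<open>0 \<in> D_X\<close>.\<close>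
  have D: "max 0 x \<in> D_X p" using x zero_in_D_X[OF p] by (simp add: max_def)
  have le: "ereal x \<le> ereal (max 0 x)" by simp
  have "ereal (max 0 x) \<le> psi_sup p"
    unfolding psi_sup_def using Psi_eq[OF p D] by (intro Sup_upper imageI) simp
  moreover have "ereal (max 0 x) \<le> phi_sup p"
    unfolding phi_sup_def using Phi_eq[OF p D] by (intro Sup_upper imageI) simp
  ultimately have "ereal x \<le> psi_sup p" "ereal x \<le> phi_sup p"
    using le by (simp_all only: order_trans[OF le])
  then show ?thesis by simp
qed

section \<open>Continuity and convexity in the parameter\<close>

text \<open>
  Dominated convergence in the form used for \<open>\<Psi>\<close> and \<open>\<Phi>\<close>; in both cases the dominating function is
  the sum of the absolute integrands at the two endpoints of the parameter interval.
\<close>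

lemma continuous_on_parameter_integral:
  fixes f :: "real \<Rightarrow> real \<Rightarrow> real"
  assumes int: "\<And>u. u \<in> {a..b} \<Longrightarrow> integrable m (f u)"
    and cont: "\<And>x. continuous_on {a..b} (\<lambda>u. f u x)"
    and w: "integrable m w" "AE x in m. \<forall>u\<in>{a..b}. \<bar>f u x\<bar> \<le> w x"
  shows "continuous_on {a..b} (\<lambda>u. integral\<^sup>L m (f u))"
proof (rule continuous_on_sequentiallyI)
  fix v :: "nat \<Rightarrow> real" and u assume v: "\<forall>n. v n \<in> {a..b}" "u \<in> {a..b}" "v \<longlonglongrightarrow> u"
  show "(\<lambda>n. integral\<^sup>L m (f (v n))) \<longlonglongrightarrow> integral\<^sup>L m (f u)"
  proof (rule integral_dominated_convergence[OF _ _ w(1)])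
    show "AE x in m. (\<lambda>n. f (v n) x) \<longlonglongrightarrow> f u x"
      using v cont by (intro AE_I2) (auto simp: continuous_on_sequentially comp_def)
    show "AE x in m. norm (f (v n) x) \<le> w x" for n
      using w(2) v by (auto elim!: eventually_mono)
  qed (use int v in \<open>auto intro: borel_measurable_integrable\<close>)
qed

text \<open>
  Compact intervals with right endpoint in \<open>D\<close> form neighbourhoods relative to \<open>D\<close>, also at a
  largest element of \<open>D\<close>. So dominated convergence on compact intervals gives continuity up to a
  right endpoint of \<open>D_X\<close> that belongs to \<open>D_X\<close>.
\<close>

lemma continuous_on_downward_closed:
  fixes F :: "real \<Rightarrow> real"
  assumes down: "\<And>u v. v \<in> D \<Longrightarrow> u \<le> v \<Longrightarrow> u \<in> D"
    and cont: "\<And>a b. b \<in> D \<Longrightarrow> continuous_on {a..b} F"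
  shows "continuous_on D F"
  unfolding continuous_on_eq_continuous_within
proof
  fix x assume x: "x \<in> D"
  obtain b S where b: "b \<in> D" "x \<le> b" "open S" "x \<in> S" "S \<subseteq> {x - 1<..}" "D \<inter> S \<subseteq> {..b}"
  proof (cases "\<exists>b\<in>D. x < b")
    case True
    then obtain b where "b \<in> D" "x < b" by blast
    then show ?thesis by (intro that[of b "{x - 1<..<b}"]) auto
  next
    case False
    then show ?thesis using x by (intro that[of x "{x - 1<..}"]) auto
  qed
  have "D \<inter> S = {x - 1..b} \<inter> S" using b down by fastforce
  then have "at x within D = at x within {x - 1..b}"
    using b by (intro at_within_nhd[of x S]) auto
  moreover have "continuous (at x within {x - 1..b}) F"
    using cont[OF b(1), of "x - 1"] b(2) by (simp add: continuous_on_eq_continuous_within)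
  ultimately show "continuous (at x within D) F" by simp
qed

lemma exp_minus_linear_nonneg: "0 \<le> exp (u * x) - 1 - u * x" for u x :: real
  using exp_ge_add_one_self[of "u * x"] by linarith

lemma convex_on_exp_minus_linear: "convex_on UNIV (\<lambda>u. exp (u * x) - 1 - u * x)" for x :: real
proof (rule convex_on_realI)
  show "((\<lambda>u. exp (u * x) - 1 - u * x) has_real_derivative (x * exp (u * x) - x)) (at u)" for u
    by (auto intro!: derivative_eq_intros)
  show "x * exp (u * x) - x \<le> x * exp (v * x) - x" if "u \<le> v" for u v
    using that by (cases "0 \<le> x") (auto intro: mult_left_mono mult_left_mono_neg mult_right_mono mult_right_mono_neg)
qed auto

lemma Psi_continuous_Icc:
  assumes p: "admissible p" and b: "b \<in> D_X p"
  shows "continuous_on {a..b} (\<lambda>u. real_of_ereal (Psi p u))"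
proof (cases "a \<le> b")
  case True
  have D: "u \<in> D_X p" if "u \<in> {a..b}" for u using that b D_X_downward_closed by auto
  have int: "integrable (levy_nu p) (\<lambda>x. exp (u * x) - 1)" if "u \<in> {a..b}" for u
    using D[OF that] p by (intro Psi_integrable) (auto simp: admissible_def D_X_iff)
  have nu_pos: "AE x in levy_nu p. 0 < x"
    using levy_measure_nonneg_AE_pos p unfolding admissible_def by blast
  have "AE x in levy_nu p. \<forall>u\<in>{a..b}. \<bar>exp (u * x) - 1\<bar> \<le> \<bar>exp (a * x) - 1\<bar> + \<bar>exp (b * x) - 1\<bar>"
    using nu_pos
  proof eventually_elim
    case (elim x)
    \<comment> \<open>Jumps are positive, so the integrand is monotone in \<open>u\<close> and lies between its endpoint values.\<close>
    have bnd: "exp (a * x) \<le> exp (u * x)" "exp (u * x) \<le> exp (b * x)" if "u \<in> {a..b}" for u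
      using that elim by auto
    then have "\<bar>exp (u * x) - 1\<bar> \<le> \<bar>exp (a * x) - 1\<bar> + \<bar>exp (b * x) - 1\<bar>" if u: "u \<in> {a..b}" for u
      using bnd[OF u] by linarith
    then show ?case by blast
  qed
  then have "continuous_on {a..b} (\<lambda>u. LINT x|levy_nu p. exp (u * x) - 1)"
    using True int by (intro continuous_on_parameter_integral) (auto intro!: continuous_intros)
  then have "continuous_on {a..b} (\<lambda>u. beta p * u + (LINT x|levy_nu p. exp (u * x) - 1))"
    by (intro continuous_intros)
  then show ?thesis by (rule continuous_on_eq) (simp add: Psi_eq[OF p D])
qed simp

lemma Psi_continuous:
  assumes "admissible p"
  shows "continuous_on (D_X p) (\<lambda>u. real_of_ereal (Psi p u))"
  by (rule continuous_on_downward_closed[OF D_X_downward_closed Psi_continuous_Icc[OF assms]])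

definition Phi_jump :: "cbitcl_params \<Rightarrow> real \<Rightarrow> real" where
  "Phi_jump p u = (LINT x|levy_pi p. exp (u * x) - 1 - u * x)"

lemma Phi_jump_integrable:
  assumes "admissible p" "u \<in> D_X p"
  shows "integrable (levy_pi p) (\<lambda>x. exp (u * x) - 1 - u * x)"
  using assms by (intro Phi_integrable) (auto simp: admissible_def D_X_iff)

lemma Phi_jump_nonneg: "0 \<le> Phi_jump p u"
  unfolding Phi_jump_def by (intro integral_nonneg_AE AE_I2 exp_minus_linear_nonneg)

lemma Phi_jump_continuous_Icc:
  assumes p: "admissible p" and b: "b \<in> D_X p"
  shows "continuous_on {a..b} (Phi_jump p)"
proof (cases "a \<le> b")
  case True
  have D: "u \<in> D_X p" if "u \<in> {a..b}" for u using that b D_X_downward_closed by auto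
  have int: "integrable (levy_pi p) (\<lambda>x. exp (u * x) - 1 - u * x)" if "u \<in> {a..b}" for u
    using Phi_jump_integrable[OF p D[OF that]] .
  have "\<bar>exp (u * x) - 1 - u * x\<bar> \<le> (exp (a * x) - 1 - a * x) + (exp (b * x) - 1 - b * x)"
    if u: "u \<in> {a..b}" for u x
  proof -
    \<comment> \<open>A convex function attains its maximum over \<open>[a, b]\<close> at an endpoint.\<close>
    have "convex_on {a..b} (\<lambda>u. exp (u * x) - 1 - u * x)"
      using convex_on_exp_minus_linear by (rule convex_on_subset) auto
    from convex_on_le_max[OF this u]
    have "exp (u * x) - 1 - u * x \<le> max (exp (a * x) - 1 - a * x) (exp (b * x) - 1 - b * x)" .
    then show ?thesis
      using exp_minus_linear_nonneg[of a x] exp_minus_linear_nonneg[of b x]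
        exp_minus_linear_nonneg[of u x] by linarith
  qed
  then show ?thesis
    unfolding Phi_jump_def using True int
    by (intro continuous_on_parameter_integral[where
          w = "\<lambda>x. (exp (a * x) - 1 - a * x) + (exp (b * x) - 1 - b * x)"] Bochner_Integration.integrable_add)
      (auto intro!: continuous_intros AE_I2 simp del: Bochner_Integration.integrable_diff)
qed simp

lemma Phi_jump_continuous:
  assumes "admissible p"
  shows "continuous_on (D_X p) (Phi_jump p)"
  by (rule continuous_on_downward_closed[OF D_X_downward_closed Phi_jump_continuous_Icc[OF assms]])

lemma convex_D_X: "convex (D_X p)"
  unfolding convex_def
proof (intro ballI allI impI)
  fix x y u v :: real assume h: "x \<in> D_X p" "y \<in> D_X p" "0 \<le> u" "0 \<le> v" "u + v = 1"
  then have "u *\<^sub>R x + v *\<^sub>R y \<le> max x y"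
    using convex_bound_le[of x "max x y" y u v] by simp
  moreover have "max x y \<in> D_X p" using h by (simp add: max_def)
  ultimately show "u *\<^sub>R x + v *\<^sub>R y \<in> D_X p" using D_X_downward_closed by blast
qed

lemma Phi_jump_convex:
  assumes p: "admissible p"
  shows "convex_on (D_X p) (Phi_jump p)"
proof (rule convex_onI[OF _ convex_D_X])
  fix t x y :: real assume t: "0 < t" "t < 1" and xy: "x \<in> D_X p" "y \<in> D_X p"
  let ?z = "(1 - t) *\<^sub>R x + t *\<^sub>R y"
  have z: "?z \<in> D_X p" using convexD_alt[OF convex_D_X xy, of t] t by simp
  have "Phi_jump p ?z \<le> (LINT s|levy_pi p. (1 - t) * (exp (x * s) - 1 - x * s) + t * (exp (y * s) - 1 - y * s))"
    unfolding Phi_jump_def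
  proof (rule integral_mono)
    show "exp (?z * s) - 1 - ?z * s
        \<le> (1 - t) * (exp (x * s) - 1 - x * s) + t * (exp (y * s) - 1 - y * s)" for s
      using convex_onD[OF convex_on_exp_minus_linear[of s], of t x y] t by simp
  qed (use Phi_jump_integrable[OF p] xy z in auto)
  also have "\<dots> = (1 - t) * Phi_jump p x + t * Phi_jump p y"
    using Phi_jump_integrable[OF p] xy by (simp add: Phi_jump_def)
  finally show "Phi_jump p ?z \<le> (1 - t) * Phi_jump p x + t * Phi_jump p y" .
qed

text \<open>
  The right-hand side of the equation for \<open>V\<close> as a real function. It carries the extended-real value
  on \<open>D_X\<close>, by \<open>riccati_rhs_eq_field\<close>.
\<close>

definition riccati_field :: "cbitcl_params \<Rightarrow> real \<Rightarrow> real \<Rightarrow> real \<Rightarrow> real" where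
  "riccati_field p u2 u3 x = real_of_ereal (riccati_rhs p u2 u3 x)"

lemma riccati_rhs_formula:
  assumes p: "admissible p" and u3: "u3 \<in> D_Z p" and x: "x \<in> D_X p"
  shows "riccati_rhs p u2 u3 x = ereal (1 / 2 * (sigma_X p)\<^sup>2 * x\<^sup>2 + Phi_jump p x
    + ((- b_X p + rho p * sigma_X p * sigma_Z p * u3) * x + (u2 + real_of_ereal (Xi p u3))))"
proof -
  obtain c where "Xi p u3 = ereal c" using Xi_finite[OF p u3] .
  then show ?thesis
    by (simp add: riccati_rhs_def Phi_eq[OF p x] Phi_jump_def algebra_simps)
qed

lemma riccati_rhs_eq_field:
  assumes "admissible p" "u3 \<in> D_Z p" "x \<in> D_X p"
  shows "riccati_rhs p u2 u3 x = ereal (riccati_field p u2 u3 x)"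
  by (simp add: riccati_rhs_formula[OF assms] riccati_field_def)

lemma riccati_field_formula:
  assumes "admissible p" "u3 \<in> D_Z p" "x \<in> D_X p"
  shows "riccati_field p u2 u3 x = 1 / 2 * (sigma_X p)\<^sup>2 * x\<^sup>2 + Phi_jump p x
    + ((- b_X p + rho p * sigma_X p * sigma_Z p * u3) * x + (u2 + real_of_ereal (Xi p u3)))"
  by (simp add: riccati_rhs_formula[OF assms] riccati_field_def)

lemma riccati_field_continuous:
  assumes "admissible p" "u3 \<in> D_Z p"
  shows "continuous_on (D_X p) (riccati_field p u2 u3)"
proof -
  have "continuous_on (D_X p) (\<lambda>x. 1 / 2 * (sigma_X p)\<^sup>2 * x\<^sup>2 + Phi_jump p x
    + ((- b_X p + rho p * sigma_X p * sigma_Z p * u3) * x + (u2 + real_of_ereal (Xi p u3))))"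
    by (intro continuous_intros Phi_jump_continuous assms)
  then show ?thesis by (rule continuous_on_eq) (rule riccati_field_formula[OF assms, symmetric])
qed

lemma riccati_field_convex:
  assumes "admissible p" "u3 \<in> D_Z p"
  shows "convex_on (D_X p) (riccati_field p u2 u3)"
proof -
  define k c where "k = - b_X p + rho p * sigma_X p * sigma_Z p * u3"
    and "c = u2 + real_of_ereal (Xi p u3)"
  have "convex_on (D_X p) (\<lambda>x. 1 / 2 * (sigma_X p)\<^sup>2 * x\<^sup>2)"
    using convex_D_X by (intro convex_on_cmul convex_on_subset[OF convex_power2]) auto
  moreover have "convex_on (D_X p) (\<lambda>x. k * x + c)"
    using convex_D_X by (intro convex_onI) (auto simp: algebra_simps)
  ultimately have g: "convex_on (D_X p) (\<lambda>x. 1 / 2 * (sigma_X p)\<^sup>2 * x\<^sup>2 + Phi_jump p x + (k * x + c))"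
    by (intro convex_on_add[OF convex_on_add] Phi_jump_convex assms(1))
  show ?thesis
  proof (rule convex_onI[OF _ convex_D_X])
    fix t x y :: real assume t: "0 < t" "t < 1" and xy: "x \<in> D_X p" "y \<in> D_X p"
    then have "(1 - t) *\<^sub>R x + t *\<^sub>R y \<in> D_X p"
      using convexD_alt[OF convex_D_X xy, of t] by simp
    then show "riccati_field p u2 u3 ((1 - t) *\<^sub>R x + t *\<^sub>R y)
        \<le> (1 - t) * riccati_field p u2 u3 x + t * riccati_field p u2 u3 y"
      using convex_onD[OF g, of t x y] t xy
      by (simp only: riccati_field_formula[OF assms] k_def c_def)
  qed
qed

lemma riccati_field_above_line:
  assumes "admissible p" "u3 \<in> D_Z p" "x \<in> D_X p"
  shows "(- b_X p + rho p * sigma_X p * sigma_Z p * u3) * x + (u2 + real_of_ereal (Xi p u3))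
    \<le> riccati_field p u2 u3 x"
  using Phi_jump_nonneg[of p x] by (simp add: riccati_field_formula[OF assms])

section \<open>Lifetime of the Riccati system\<close>

text \<open>
  Only the equation for \<open>V\<close> has to be solved: the image of a compact time interval under \<open>V\<close> is
  contained in \<open>D_X\<close>, where \<open>\<Psi>\<close> is continuous, so the integral defining \<open>U\<close> exists.
\<close>

lemma riccati_solutionI:
  assumes p: "admissible p" and V0: "V 0 = u1"
    and V: "\<And>t. 0 \<le> t \<Longrightarrow> ennreal t < \<tau> \<Longrightarrow> V t \<in> D_X p
      \<and> (V has_real_derivative riccati_field p u2 u3 (V t)) (at t)"
  shows "riccati_solution p u1 u2 u3 \<tau> (\<lambda>t. LBINT s:{0..t}. real_of_ereal (Psi p (V s))) V"
  unfolding riccati_solution_def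
proof (intro conjI allI impI V0 refl)
  fix t assume t: "0 \<le> t" "ennreal t < \<tau>"
  then show "V t \<in> D_X p" using V by blast
  show "(V has_real_derivative real_of_ereal (riccati_rhs p u2 u3 (V t)))
      (at t within {s. 0 \<le> s \<and> ennreal s < \<tau>})"
    using V[OF t] unfolding riccati_field_def by (auto intro: has_field_derivative_at_within)
  have s: "0 \<le> s \<and> ennreal s < \<tau>" if "s \<in> {0..t}" for s
    using that t le_less_trans[of "ennreal s" "ennreal t" \<tau>] by (simp add: ennreal_leI)
  have "isCont V r" "V r \<in> D_X p" if "r \<in> {0..t}" for r
    using V[of r] s[OF that] by (auto intro: DERIV_isCont)
  then have "continuous_on {0..t} V" "V ` {0..t} \<subseteq> D_X p"
    by (auto intro: continuous_at_imp_continuous_on)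
  then have "continuous_on {0..t} (\<lambda>s. real_of_ereal (Psi p (V s)))"
    by (rule continuous_on_compose2[OF Psi_continuous[OF p]])
  then show "set_integrable lborel {0..t} (\<lambda>s. real_of_ereal (Psi p (V s)))"
    by (rule borel_integrable_atLeastAtMost')
qed

text \<open>
  The supremum \<open>\<chi>\<close> need not be attained to the right of \<open>u1\<close>. But if \<open>F\<close> were positive on \<open>D_X\<close> from
  \<open>u1\<close> onwards, continuity at \<open>u1\<close> would make it positive on a left neighbourhood too and push \<open>\<chi>\<close>
  below \<open>u1\<close>. So \<open>F\<close> becomes nonpositive at or after \<open>u1\<close>, and the flow is global.
\<close>

lemma riccati_lifetime_below_chi:
  assumes p: "admissible p" and u1: "u1 \<in> D_X p" and u3: "u3 \<in> D_Z p"
    and le: "ereal u1 \<le> chi p u2 u3"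
  shows "riccati_lifetime p u1 u2 u3 = \<infinity>"
proof -
  define F where "F = riccati_field p u2 u3"
  have F: "\<And>x. x \<in> D_X p \<Longrightarrow> riccati_rhs p u2 u3 x = ereal (F x)" "continuous_on (D_X p) F"
    unfolding F_def by (fact riccati_rhs_eq_field[OF p u3], fact riccati_field_continuous[OF p u3])
  have turn: "\<exists>b\<in>D_X p. u1 \<le> b \<and> F b \<le> 0"
  proof (rule ccontr)
    assume "\<not> ?thesis"
    then have pos: "0 < F b" if "b \<in> D_X p" "u1 \<le> b" for b using that by force
    obtain e where e: "e > 0" "\<And>x. x \<in> D_X p \<Longrightarrow> dist x u1 < e \<Longrightarrow> dist (F x) (F u1) < F u1"
      using F(2) u1 pos[OF u1 order_refl] unfolding continuous_on_iff by metis
    have "x \<le> u1 - e" if x: "x \<in> S_set p u2 u3" for x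
    proof (rule ccontr)
      assume far: "\<not> x \<le> u1 - e"
      have D: "x \<in> D_X p" and "F x \<le> 0" using x F(1)[of x] by (auto simp: S_set_def)
      then have "x < u1" using pos[of x] by fastforce
      then have "dist x u1 < e" using far by (simp add: dist_real_def)
      then show False using e(2)[OF D] \<open>F x \<le> 0\<close> by (simp add: dist_real_def)
    qed
    then have "chi p u2 u3 \<le> ereal (u1 - e)"
      unfolding chi_def by (intro Sup_least) auto
    then have "ereal u1 \<le> ereal (u1 - e)" using le by (rule order_trans[rotated])
    then show False using e by simp
  qed
  obtain V where V: "V 0 = u1"
      "\<And>t. 0 \<le> t \<Longrightarrow> V t \<in> D_X p \<and> (V has_real_derivative F (V t)) (at t)"
  proof (rule convex_flow_global[OF _ F(2) riccati_field_convex[where ?u2.0 = u2, OF p u3, folded F_def]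
        riccati_field_above_line[where ?u2.0 = u2, OF p u3, folded F_def] u1 turn])
    show "x \<in> D_X p" if "y \<in> D_X p" "x \<le> y" for x y
      using D_X_downward_closed that by blast
    fix V assume "V 0 = u1"
      "\<And>t. 0 \<le> t \<Longrightarrow> V t \<in> D_X p \<and> (V has_real_derivative F (V t)) (at t)"
    then show thesis by (rule that)
  qed
  have "riccati_solution p u1 u2 u3 \<infinity> (\<lambda>t. LBINT s:{0..t}. real_of_ereal (Psi p (V s))) V"
    using V(2) unfolding F_def by (intro riccati_solutionI[where V = V, OF p V(1)]) blast
  then have "\<infinity> \<le> riccati_lifetime p u1 u2 u3"
    unfolding riccati_lifetime_def by (intro Sup_upper) blast
  then show ?thesis by (simp add: top_unique)
qed

text \<open>
  Here \<open>F > 0\<close> on \<open>D_X\<close> from \<open>u1\<close> onwards. Separation of variables provides a solution up to the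
  travel time to \<open>min \<psi> \<phi>\<close>, and no solution can live longer because its values stay in \<open>D_X\<close>, hence
  do not exceed \<open>min \<psi> \<phi>\<close>.
\<close>

lemma riccati_lifetime_above_chi:
  assumes p: "admissible p" and u1: "u1 \<in> D_X p" and u3: "u3 \<in> D_Z p"
    and gt: "chi p u2 u3 < ereal u1"
  shows "riccati_lifetime p u1 u2 u3
    = travel_time (riccati_field p u2 u3) u1 (min (psi_sup p) (phi_sup p))"
proof -
  define F where "F = riccati_field p u2 u3"
  define \<kappa> where "\<kappa> = min (psi_sup p) (phi_sup p)"
  have F: "\<And>x. x \<in> D_X p \<Longrightarrow> riccati_rhs p u2 u3 x = ereal (F x)" "continuous_on (D_X p) F"
    unfolding F_def by (fact riccati_rhs_eq_field[OF p u3], fact riccati_field_continuous[OF p u3])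
  have pos: "0 < F x" if x: "x \<in> D_X p" "u1 \<le> x" for x
  proof (rule ccontr)
    assume "\<not> 0 < F x"
    then have "x \<in> S_set p u2 u3" using x F(1) by (simp add: S_set_def)
    then have "ereal x \<le> chi p u2 u3" unfolding chi_def by (intro Sup_upper) simp
    then have "ereal x < ereal u1" using gt by (rule le_less_trans)
    then show False using x by simp
  qed
  have below: "x \<in> D_X p" if "ereal x < \<kappa>" for x
    using less_min_psi_phi_imp_D_X[OF p] that by (simp add: \<kappa>_def)
  have "travel_time F u1 \<kappa> \<le> riccati_lifetime p u1 u2 u3"
  proof (cases "ereal u1 < \<kappa>")
    case True
    have posk: "0 < F x" if "u1 \<le> x" "ereal x < \<kappa>" for x using pos[OF below] that by simp
    have cont: "continuous_on {x. u1 \<le> x \<and> ereal x < \<kappa>} F"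
      using F(2) by (rule continuous_on_subset) (use below in auto)
    obtain V where V: "V 0 = u1" "\<And>t. 0 \<le> t \<Longrightarrow> ennreal t < travel_time F u1 \<kappa> \<Longrightarrow>
        u1 \<le> V t \<and> ereal (V t) < \<kappa> \<and> (V has_real_derivative F (V t)) (at t)"
    proof (rule increasing_flow_exists[OF True cont posk])
      fix V assume "V 0 = u1" "\<And>t. 0 \<le> t \<Longrightarrow> ennreal t < travel_time F u1 \<kappa> \<Longrightarrow>
        u1 \<le> V t \<and> ereal (V t) < \<kappa> \<and> (V has_real_derivative F (V t)) (at t)"
      then show thesis by (rule that)
    qed
    have "riccati_solution p u1 u2 u3 (travel_time F u1 \<kappa>)
        (\<lambda>t. LBINT s:{0..t}. real_of_ereal (Psi p (V s))) V"
    proof (rule riccati_solutionI[where V = V, OF p V(1)])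
      fix t assume "0 \<le> t" "ennreal t < travel_time F u1 \<kappa>"
      from V(2)[OF this] below[of "V t"]
      show "V t \<in> D_X p \<and> (V has_real_derivative riccati_field p u2 u3 (V t)) (at t)"
        unfolding F_def by blast
    qed
    then show ?thesis
      unfolding riccati_lifetime_def by (intro Sup_upper) blast
  next
    case False
    \<comment> \<open>The start is already the right endpoint of the domain, and the travel time is \<open>0\<close>.\<close>
    have "{x. u1 < x \<and> ereal x < \<kappa>} = {}"
    proof -
      have "\<not> ereal x < \<kappa>" if "u1 < x" for x
        using False that less_trans[of "ereal u1" "ereal x" \<kappa>] by auto
      then show ?thesis by auto
    qed
    then show ?thesis by (simp add: travel_time_def)
  qed
  moreover have "riccati_lifetime p u1 u2 u3 \<le> travel_time F u1 \<kappa>"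
    unfolding riccati_lifetime_def
  proof (rule Sup_least)
    fix \<tau> assume "\<tau> \<in> {\<tau>. \<exists>U V. riccati_solution p u1 u2 u3 \<tau> U V}"
    then obtain U V where sol: "riccati_solution p u1 u2 u3 \<tau> U V" by blast
    have bound: "ennreal t \<le> travel_time F u1 \<kappa>" if t: "0 \<le> t" "ennreal t < \<tau>" for t
    proof -
      have s: "0 \<le> s \<and> ennreal s < \<tau>" if "s \<in> {0..t}" for s
        using that t le_less_trans[of "ennreal s" "ennreal t" \<tau>] by (simp add: ennreal_leI)
      have D: "V s \<in> D_X p" if "s \<in> {0..t}" for s
        using sol s[OF that] by (simp add: riccati_solution_def)
      have "(V has_real_derivative F (V r)) (at r within {0..t})" if r: "r \<in> {0..t}" for r
      proof (rule DERIV_subset)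
        show "(V has_real_derivative F (V r)) (at r within {s. 0 \<le> s \<and> ennreal s < \<tau>})"
          using sol s[OF r] by (simp add: riccati_solution_def F_def riccati_field_def)
        show "{0..t} \<subseteq> {s. 0 \<le> s \<and> ennreal s < \<tau>}" using s by blast
      qed
      moreover have "ereal (V t) \<le> \<kappa>"
        using D_X_le_min_psi_phi[OF p D[of t]] t by (simp add: \<kappa>_def)
      moreover have "V ` {0..t} \<subseteq> D_X p" using D by blast
      moreover have "V 0 = u1" using sol by (simp add: riccati_solution_def)
      ultimately show ?thesis
        using t pos by (intro positive_flow_time_le continuous_on_subset[OF F(2)]) auto
    qed
    show "\<tau> \<le> travel_time F u1 \<kappa>"
    proof (rule ccontr)
      assume "\<not> \<tau> \<le> travel_time F u1 \<kappa>"
      then obtain z where z: "travel_time F u1 \<kappa> < z" "z < \<tau>"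
        using dense[of "travel_time F u1 \<kappa>" \<tau>] by (auto simp: not_le)
      then have "z \<noteq> \<infinity>" by auto
      then obtain t where "0 \<le> t" "z = ennreal t" by (cases z) auto
      then show False using bound[of t] z by (simp add: not_le[symmetric])
    qed
  qed
  ultimately show ?thesis unfolding F_def \<kappa>_def by (intro antisym)
qed

theorem theorem3p4:
  fixes p :: cbitcl_params
    and P :: "'a measure"
    and X0 :: real
    and X Z :: "real \<Rightarrow> 'a \<Rightarrow> real"
    and u1 u2 u3 :: real
  assumes "admissible p"
    and "CBITCL P X0 p X Z"
    and "min (psi_sup p) (phi_sup p) < \<infinity> \<longrightarrow>
      (\<integral>\<^sup>+x\<in>{1..}. ennreal (x * exp (real_of_ereal (min (psi_sup p) (phi_sup p)) * x)) \<partial>levy_pi p) < \<infinity>"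
    and "u1 \<in> D_X p"
    and "u3 \<in> D_Z p"
  shows "(ereal u1 \<le> chi p u2 u3 \<longrightarrow> riccati_lifetime p u1 u2 u3 = \<infinity>) \<and>
    (chi p u2 u3 < ereal u1 \<longrightarrow>
       riccati_lifetime p u1 u2 u3 =
         (\<integral>\<^sup>+x\<in>{x. u1 < x \<and> ereal x < min (psi_sup p) (phi_sup p)}.
            ennreal (1 / real_of_ereal (riccati_rhs p u2 u3 x)) \<partial>lborel))"
proof (intro conjI impI)
  show "riccati_lifetime p u1 u2 u3 = \<infinity>" if "ereal u1 \<le> chi p u2 u3"
    using assms(1,4,5) that by (rule riccati_lifetime_below_chi)
  show "riccati_lifetime p u1 u2 u3 =
      (\<integral>\<^sup>+x\<in>{x. u1 < x \<and> ereal x < min (psi_sup p) (phi_sup p)}.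
        ennreal (1 / real_of_ereal (riccati_rhs p u2 u3 x)) \<partial>lborel)"
    if "chi p u2 u3 < ereal u1"
    using riccati_lifetime_above_chi[OF assms(1,4,5) that]
    by (simp only: travel_time_def riccati_field_def)
qed

end
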